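(* Consider the special case of $mR\{\text{1 or all}\}D$ (each demand $d$ has $|M_d|=1$ or $M_d=R$) in which all travel times are zero and all service times are one ($\Delta_d=1$ for every demand $d$). This special case is solvable (an optimal solution can be computed) in polynomial time.
   Context: Problem $mRmD$ (heterogeneous multi-resource allocation with subset demand requests). An instance consists of: a finite set $D$ of demands; a finite set $R$ of resource types; for each $r\in R$ a finite set $S^r$ of starting locations and, for each $s\in S^r$, a number $l_s^r$ of resources of type $r$ starting at $s$; for each demand $d\in D$ a nonempty set $M_d\subseteq R$ of required resource types, a service start time $\tau_d\ge 0$, a service duration (service time) $\Delta_d>0$ and a reward $w_d\ge 0$; and travel times $f_{xy}\ge 0$ between any two locations ($f_{ij}$ is the travel time between the locations of demands $i$ and $j$, and $f_{sd}$ that from starting location $s$ to the location of demand $d$). All these numbers are integers. Demand $d$ requires one unit of every resource type in $M_d$ simultaneously at time $\tau_d$ for duration $\Delta_d$. A resource of type $r$ starting at $s\in S^r$ can serve $d$ as its first demand iff $r\in M_d$ and $f_{sd}\le\tau_d$; a resource of type $r$ can serve $j$ immediately after $i$ iff $r\in M_i\cap M_j$ and $\tau_i+\Delta_i+f_{ij}\le\tau_j$. A feasible solution assigns to each resource a (possibly empty) path, i.e. a sequence of demands whose first element can be served first and in which each consecutive pair can be served one immediately after the other. Demand $d$ is met if, for every $r\in M_d$, at least one resource of type $r$ has $d$ on its path. The objective is to maximize the sum of $w_d$ over met demands $d$. *)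

theory Defs
  imports
    Main
    "HOL-Library.Log_Nat"
    "HOL-Computational_Algebra.Polynomial"
begin

section \<open>Polynomial time\<close>

text \<open>
  The model of computation is a first-order, call-by-value language with general recursion
  over S-expressions whose atoms are natural numbers.  It is used with logarithmic cost: each
  evaluation step is charged for the bit length of all the data it reads or produces, shared
  substructures being counted once per occurrence.  A run of cost \<open>t\<close> therefore only handles
  data of size at most \<open>t\<close>, and each step is polynomial-time computable on a Turing machine, so
  that polynomial cost here agrees with polynomial time on Turing machines.
\<close>

datatype sexp = Num nat | Node sexp sexp

text \<open>\<open>floorlog 2 n\<close> is the number of binary digits of \<open>n\<close>.\<close>

fun sexp_size :: "sexp \<Rightarrow> nat" where
  "sexp_size (Num n) = 1 + floorlog 2 n"
| "sexp_size (Node a b) = 1 + sexp_size a + sexp_size b"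

datatype prim = Car | Cdr | Pairing | Plus | Minus | Less_Than

text \<open>
  \<open>Var i\<close> is a de Bruijn index into the environment, \<open>Call g es\<close> calls the \<open>g\<close>-th function of
  the program, whose body sees exactly the values of \<open>es\<close>.
\<close>

datatype expr =
    Var nat
  | Lit nat
  | Prim prim "expr list"
  | Cond expr expr expr
  | Bind expr expr
  | Call nat "expr list"

type_synonym program = "expr list"

text \<open>Ill-typed applications return \<open>Num 0\<close>; \<open>Minus\<close> is truncated subtraction.\<close>

fun apply_prim :: "prim \<Rightarrow> sexp list \<Rightarrow> sexp" where
  "apply_prim Car [Node a b] = a"
| "apply_prim Cdr [Node a b] = b"
| "apply_prim Pairing [a, b] = Node a b"
| "apply_prim Plus [Num m, Num n] = Num (m + n)"
| "apply_prim Minus [Num m, Num n] = Num (m - n)"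
| "apply_prim Less_Than [Num m, Num n] = Num (if m < n then 1 else 0)"
| "apply_prim _ _ = Num 0"

text \<open>
  \<open>eval P env e v t\<close>: in program \<open>P\<close> and environment \<open>env\<close>, the expression \<open>e\<close> terminates with
  value \<open>v\<close> at cost \<open>t\<close>.
\<close>

inductive eval :: "program \<Rightarrow> sexp list \<Rightarrow> expr \<Rightarrow> sexp \<Rightarrow> nat \<Rightarrow> bool"
  and evals :: "program \<Rightarrow> sexp list \<Rightarrow> expr list \<Rightarrow> sexp list \<Rightarrow> nat \<Rightarrow> bool"
  for P :: program
where
  eval_Var: "i < length env \<Longrightarrow> eval P env (Var i) (env ! i) (1 + sexp_size (env ! i))"
| eval_Lit: "eval P env (Lit n) (Num n) (1 + sexp_size (Num n))"
| eval_Prim: "evals P env es vs t \<Longrightarrow> v = apply_prim f vs \<Longrightarrow>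
    eval P env (Prim f es) v (1 + t + sum_list (map sexp_size vs) + sexp_size v)"
| eval_Cond_true: "eval P env b u t \<Longrightarrow> u \<noteq> Num 0 \<Longrightarrow> eval P env e1 v t' \<Longrightarrow>
    eval P env (Cond b e1 e2) v (1 + t + t')"
| eval_Cond_false: "eval P env b (Num 0) t \<Longrightarrow> eval P env e2 v t' \<Longrightarrow>
    eval P env (Cond b e1 e2) v (1 + t + t')"
| eval_Bind: "eval P env e1 u t \<Longrightarrow> eval P (u # env) e2 v t' \<Longrightarrow>
    eval P env (Bind e1 e2) v (1 + t + t')"
| eval_Call: "evals P env es vs t \<Longrightarrow> g < length P \<Longrightarrow> eval P vs (P ! g) v t' \<Longrightarrow>
    eval P env (Call g es) v (1 + t + t')"
| evals_Nil: "evals P env [] [] 0"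
| evals_Cons: "eval P env e v t \<Longrightarrow> evals P env es vs t' \<Longrightarrow>
    evals P env (e # es) (v # vs) (t + t')"

inductive_cases eval_VarE: "eval P env (Var i) v t"
inductive_cases eval_LitE: "eval P env (Lit n) v t"
inductive_cases eval_PrimE: "eval P env (Prim f es) v t"
inductive_cases eval_CondE: "eval P env (Cond b e1 e2) v t"
inductive_cases eval_BindE: "eval P env (Bind e1 e2) v t"
inductive_cases eval_CallE: "eval P env (Call g es) v t"
inductive_cases evals_NilE: "evals P env [] vs t"
inductive_cases evals_ConsE: "evals P env (e # es) vs t"

lemma eval_deterministic:
  "eval P env e v t \<Longrightarrow> eval P env e v' t' \<Longrightarrow> v' = v \<and> t' = t"
  and evals_deterministic:
  "evals P env es vs s \<Longrightarrow> evals P env es vs' s' \<Longrightarrow> vs' = vs \<and> s' = s"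
proof (induction arbitrary: v' t' and vs' s' rule: eval_evals.inducts)
  case (eval_Var i env)
  then show ?case by (auto elim: eval_VarE)
next
  case (eval_Lit env n)
  then show ?case by (auto elim: eval_LitE)
next
  case (eval_Prim env es vs t v f)
  from eval_Prim.prems show ?case
    by (rule eval_PrimE) (drule eval_Prim.IH, simp add: eval_Prim.hyps)
next
  case (eval_Cond_true env b u t e1 v t'' e2)
  from eval_Cond_true.prems show ?case
    by (rule eval_CondE) (metis eval_Cond_true.IH eval_Cond_true.hyps add_Suc plus_1_eq_Suc)+
next
  case (eval_Cond_false env b t e2 v t'' e1)
  from eval_Cond_false.prems show ?case
    by (rule eval_CondE) (metis eval_Cond_false.IH add_Suc plus_1_eq_Suc)+
next
  case (eval_Bind env e1 u t e2 v t'')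
  from eval_Bind.prems show ?case
    by (rule eval_BindE) (metis eval_Bind.IH add_Suc plus_1_eq_Suc)
next
  case (eval_Call env es vs t g v t'')
  from eval_Call.prems show ?case
    by (rule eval_CallE) (metis eval_Call.IH add_Suc plus_1_eq_Suc)
next
  case (evals_Nil env)
  then show ?case by (auto elim: evals_NilE)
next
  case (evals_Cons env e v t es vs t'')
  from evals_Cons.prems show ?case
    by (rule evals_ConsE) (metis evals_Cons.IH)
qed

lemma eval_size_le_cost: "eval P env e v t \<Longrightarrow> sexp_size v \<le> t"
  and evals_size_le_cost: "evals P env es vs s \<Longrightarrow> sum_list (map sexp_size vs) \<le> s"
  by (induction rule: eval_evals.inducts) auto

text \<open>The first function of a program is its entry point.\<close>

definition runs :: "program \<Rightarrow> sexp \<Rightarrow> sexp \<Rightarrow> nat \<Rightarrow> bool" where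
  "runs P x y t \<longleftrightarrow> P \<noteq> [] \<and> eval P [x] (P ! 0) y t"

text \<open>
  One program has to produce, on every instance \<open>x\<close> of the class \<open>C\<close>, the encoding of a
  solution of \<open>x\<close>, at a cost bounded by a fixed polynomial in the size of the encoding of \<open>x\<close>.
\<close>

definition poly_time_solvable ::
    "('i \<Rightarrow> bool) \<Rightarrow> ('i \<Rightarrow> sexp) \<Rightarrow> ('i \<Rightarrow> 'o \<Rightarrow> bool) \<Rightarrow> ('o \<Rightarrow> sexp) \<Rightarrow> bool" where
  "poly_time_solvable C enc_in solves enc_out \<longleftrightarrow>
     (\<exists>(P :: program) (p :: nat poly). \<forall>x. C x \<longrightarrow>
        (\<exists>y t. solves x y \<and> runs P (enc_in x) (enc_out y) t \<and>
               t \<le> poly p (sexp_size (enc_in x))))"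


section \<open>Multi-resource allocation with subset demand requests\<close>

text \<open>
  Demands, resource types and starting locations are numbered by initial segments of the
  natural numbers.  The starting locations of type \<open>r\<close> form the set \<open>starts I r\<close>; different
  types may share locations.  Values outside the index ranges are irrelevant.
\<close>

datatype location = Start nat | Demand nat

record mrmd =
  num_demands :: nat
  num_types :: nat
  num_starts :: nat
  starts :: "nat \<Rightarrow> nat set"
  capacity :: "nat \<Rightarrow> nat \<Rightarrow> nat"  \<comment> \<open>\<open>capacity I r s\<close> is \<open>l\<^sub>s\<^sup>r\<close>\<close>
  required :: "nat \<Rightarrow> nat set"  \<comment> \<open>\<open>M\<^sub>d\<close>\<close>
  start_time :: "nat \<Rightarrow> nat"
  duration :: "nat \<Rightarrow> nat"
  reward :: "nat \<Rightarrow> nat"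
  travel :: "location \<Rightarrow> location \<Rightarrow> nat"

definition demands :: "mrmd \<Rightarrow> nat set" where
  "demands I = {..<num_demands I}"

definition res_types :: "mrmd \<Rightarrow> nat set" where
  "res_types I = {..<num_types I}"

definition locations :: "mrmd \<Rightarrow> location set" where
  "locations I = Start ` {..<num_starts I} \<union> Demand ` demands I"

definition valid_instance :: "mrmd \<Rightarrow> bool" where
  "valid_instance I \<longleftrightarrow>
     (\<forall>r\<in>res_types I. starts I r \<subseteq> {..<num_starts I}) \<and>
     (\<forall>d\<in>demands I. required I d \<noteq> {} \<and> required I d \<subseteq> res_types I \<and> duration I d > 0)"

text \<open>A resource is a triple: its type, its starting location, and its number among the
  resources of this type starting there.\<close>

type_synonym resource = "nat \<times> nat \<times> nat"

definition resources :: "mrmd \<Rightarrow> resource set" where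
  "resources I = {(r, s, k). r \<in> res_types I \<and> s \<in> starts I r \<and> k < capacity I r s}"

definition can_serve_first :: "mrmd \<Rightarrow> nat \<Rightarrow> nat \<Rightarrow> nat \<Rightarrow> bool" where
  "can_serve_first I r s d \<longleftrightarrow>
     r \<in> required I d \<and> travel I (Start s) (Demand d) \<le> start_time I d"

definition can_serve_next :: "mrmd \<Rightarrow> nat \<Rightarrow> nat \<Rightarrow> nat \<Rightarrow> bool" where
  "can_serve_next I r i j \<longleftrightarrow>
     r \<in> required I i \<inter> required I j \<and>
     start_time I i + duration I i + travel I (Demand i) (Demand j) \<le> start_time I j"

definition is_path :: "mrmd \<Rightarrow> nat \<Rightarrow> nat \<Rightarrow> nat list \<Rightarrow> bool" where
  "is_path I r s p \<longleftrightarrow>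
     set p \<subseteq> demands I \<and>
     (p \<noteq> [] \<longrightarrow> can_serve_first I r s (hd p)) \<and>
     successively (can_serve_next I r) p"

definition feasible :: "mrmd \<Rightarrow> (resource \<Rightarrow> nat list) \<Rightarrow> bool" where
  "feasible I \<sigma> \<longleftrightarrow> (\<forall>(r, s, k)\<in>resources I. is_path I r s (\<sigma> (r, s, k)))"

definition met :: "mrmd \<Rightarrow> (resource \<Rightarrow> nat list) \<Rightarrow> nat \<Rightarrow> bool" where
  "met I \<sigma> d \<longleftrightarrow>
     (\<forall>r\<in>required I d. \<exists>s k. (r, s, k) \<in> resources I \<and> d \<in> set (\<sigma> (r, s, k)))"

definition total_reward :: "mrmd \<Rightarrow> (resource \<Rightarrow> nat list) \<Rightarrow> nat" where
  "total_reward I \<sigma> = (\<Sum>d | d \<in> demands I \<and> met I \<sigma> d. reward I d)"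

definition optimal :: "mrmd \<Rightarrow> (resource \<Rightarrow> nat list) \<Rightarrow> bool" where
  "optimal I \<sigma> \<longleftrightarrow>
     feasible I \<sigma> \<and> (\<forall>\<sigma>'. feasible I \<sigma>' \<longrightarrow> total_reward I \<sigma>' \<le> total_reward I \<sigma>)"

text \<open>
  The supplies are given in binary, so that there may be exponentially many resources.
  Solutions are therefore output as finite tables; a resource not listed has the empty path.
\<close>

type_synonym plan = "(resource \<times> nat list) list"

definition assignment_of :: "plan \<Rightarrow> resource \<Rightarrow> nat list" where
  "assignment_of pl x = (case map_of pl x of None \<Rightarrow> [] | Some p \<Rightarrow> p)"

definition optimal_plan :: "mrmd \<Rightarrow> plan \<Rightarrow> bool" where
  "optimal_plan I pl \<longleftrightarrow>
     distinct (map fst pl) \<and> fst ` set pl \<subseteq> resources I \<and> optimal I (assignment_of pl)"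

definition one_or_all :: "mrmd \<Rightarrow> bool" where
  "one_or_all I \<longleftrightarrow> (\<forall>d\<in>demands I. card (required I d) = 1 \<or> required I d = res_types I)"

definition zero_travel_times :: "mrmd \<Rightarrow> bool" where
  "zero_travel_times I \<longleftrightarrow> (\<forall>x\<in>locations I. \<forall>y\<in>locations I. travel I x y = 0)"

definition unit_service_times :: "mrmd \<Rightarrow> bool" where
  "unit_service_times I \<longleftrightarrow> (\<forall>d\<in>demands I. duration I d = 1)"


section \<open>Encodings\<close>

definition enc_list :: "('a \<Rightarrow> sexp) \<Rightarrow> 'a list \<Rightarrow> sexp" where
  "enc_list enc xs = foldr (\<lambda>x. Node (enc x)) xs (Num 0)"

text \<open>
  An instance is encoded by the numbers of demands, types and starting locations; for each
  type \<open>r\<close>, the list of pairs \<open>(s, l\<^sub>s\<^sup>r)\<close>; for each demand \<open>d\<close>, the list \<open>M\<^sub>d\<close> followed by start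
  time, duration and reward; and the matrix of travel times.
\<close>

definition location_list :: "mrmd \<Rightarrow> location list" where
  "location_list I = map Start [0..<num_starts I] @ map Demand [0..<num_demands I]"

definition enc_type :: "mrmd \<Rightarrow> nat \<Rightarrow> sexp" where
  "enc_type I r =
     enc_list (\<lambda>s. Node (Num s) (Num (capacity I r s))) (sorted_list_of_set (starts I r))"

definition enc_demand :: "mrmd \<Rightarrow> nat \<Rightarrow> sexp" where
  "enc_demand I d =
     Node (enc_list Num (sorted_list_of_set (required I d)))
          (enc_list Num [start_time I d, duration I d, reward I d])"

definition enc_instance :: "mrmd \<Rightarrow> sexp" where
  "enc_instance I =
     enc_list id
       [Num (num_demands I), Num (num_types I), Num (num_starts I),
        enc_list (enc_type I) [0..<num_types I],
        enc_list (enc_demand I) [0..<num_demands I],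
        enc_list (\<lambda>x. enc_list (\<lambda>y. Num (travel I x y)) (location_list I)) (location_list I)]"

fun enc_entry :: "resource \<times> nat list \<Rightarrow> sexp" where
  "enc_entry ((r, s, k), p) = Node (enc_list Num [r, s, k]) (enc_list Num p)"

definition enc_plan :: "plan \<Rightarrow> sexp" where
  "enc_plan pl = enc_list enc_entry pl"

end

(*
  With unit service times and no travel, a resource can serve demands of any increasing sequence of
  start times, so different start times do not interact: a set of demands can be met iff at each
  time t at most N r of its demands need type r, where N r is the supply of r (capped by the number
  of demands, as supplies are given in binary).  At a fixed time, once the number k of demands for
  all types is chosen, it is best to take the k most rewarding of these and, for each r, the N r - k
  most rewarding demands for r alone; trying all k gives the optimum.  The j-th usable resource of
  type r then serves, at each time, the j-th of the chosen demands that need r.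

  For the running time, the class of polynomial-time functions on S-expressions is shown to be
  closed under the operations in which this algorithm is written, in particular under loops over a
  list in which every iteration enlarges the state only by an additive term.
*)
theory Submission
  imports Defs
begin

section \<open>Polynomial-time functions\<close>

text \<open>No concrete program is written down: \<open>algorithm\<close> is an ordinary function on
  S-expressions, and its program exists only through the closure lemmas for \<open>fp\<close>. That
  class consists of total functions of one argument, which explains two habits: selectors return
  defaults on malformed data, and several arguments are packed into pairs and read back by
  \<open>scar\<close> and \<open>scdr\<close>. Since any polynomial bound is good enough, ranks,
  supplies and turns at a resource are computed by filtering and counting lists. Their mathematical
  counterparts are cardinalities, so correctness is largely a translation of filters into set
  comprehensions. Fixing \<open>k\<close> at one time is what decouples the types: the demands for
  \<open>r\<close> alone then compete only among themselves, for \<open>N r - k\<close> units. The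
  delicate case is a single resource type, where a demand is at once for one and for all types;
  \<open>quota\<close> and \<open>alg_selected\<close> test for all types first, so that such a
  demand is never counted in two classes.\<close>

fun shift :: "nat \<Rightarrow> expr \<Rightarrow> expr" where
  "shift k (Var i) = Var i"
| "shift k (Lit n) = Lit n"
| "shift k (Prim f es) = Prim f (map (shift k) es)"
| "shift k (Cond b e1 e2) = Cond (shift k b) (shift k e1) (shift k e2)"
| "shift k (Bind e1 e2) = Bind (shift k e1) (shift k e2)"
| "shift k (Call g es) = Call (k + g) (map (shift k) es)"

lemmas eval_Suc_intros = eval_evals.intros[simplified]

text \<open>Relocation: with \<open>Q\<close> placed in front, every call index moves by
  \<open>length Q\<close>. Values and costs are unchanged because cost does not depend on the number
  of the called function. This lets independently obtained programs be concatenated.\<close>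

lemma eval_shift:
  "eval P env e v t \<Longrightarrow> eval (Q @ map (shift (length Q)) P) env (shift (length Q) e) v t"
  and evals_shift:
  "evals P env es vs s \<Longrightarrow>
     evals (Q @ map (shift (length Q)) P) env (map (shift (length Q)) es) vs s"
  by (induction rule: eval_evals.inducts) (auto intro: eval_Suc_intros)

lemma eval_append_program: "eval P env e v t \<Longrightarrow> eval (P @ Q) env e v t"
  and evals_append_program: "evals P env es vs s \<Longrightarrow> evals (P @ Q) env es vs s"
proof (induction rule: eval_evals.inducts)
  case (eval_Call env es vs t g v t')
  then have "eval (P @ Q) vs ((P @ Q) ! g) v t'" by (simp add: nth_append)
  with eval_Call show ?case by (auto intro!: eval_Suc_intros)
qed (auto intro: eval_Suc_intros)

text \<open>De Bruijn indices count from the front, so extra values at the end are invisible. Needed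
  for \<open>Bind\<close>, which evaluates its body with the old environment still behind the new
  value.\<close>

lemma eval_append_env: "eval P env e v t \<Longrightarrow> eval P (env @ env') e v t"
  and evals_append_env: "evals P env es vs s \<Longrightarrow> evals P (env @ env') es vs s"
proof (induction rule: eval_evals.inducts)
  case (eval_Var i env)
  then have "(env @ env') ! i = env ! i" "i < length (env @ env')" by (auto simp: nth_append)
  then show ?case by (metis eval_evals.eval_Var)
qed (auto intro: eval_Suc_intros)

section \<open>Polynomial bounds and the class of polynomial-time functions\<close>

lemma poly_nat_mono: "m \<le> n \<Longrightarrow> poly p m \<le> poly p n" for p :: "nat poly"
  by (induction p) (auto intro!: add_mono mult_mono)

text \<open>Lets cost bounds be written as plain arithmetic terms; the polynomial itself is
  assembled by \<open>pb_intros\<close>.\<close>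

definition poly_bounded :: "(nat \<Rightarrow> nat) \<Rightarrow> bool" where
  "poly_bounded g \<longleftrightarrow> (\<exists>p. \<forall>n. g n \<le> poly p n)"

named_theorems pb_intros

lemma poly_bounded_const [pb_intros]: "poly_bounded (\<lambda>n. c)"
  unfolding poly_bounded_def by (rule exI[of _ "[:c:]"]) simp

lemma poly_bounded_id [pb_intros]: "poly_bounded (\<lambda>n. n)"
  unfolding poly_bounded_def by (rule exI[of _ "[:0, 1:]"]) simp

lemma poly_bounded_add [pb_intros]:
  assumes "poly_bounded f" "poly_bounded g" shows "poly_bounded (\<lambda>n. f n + g n)"
proof -
  from assms obtain p q where "\<forall>n. f n \<le> poly p n" "\<forall>n. g n \<le> poly q n"
    by (auto simp: poly_bounded_def)
  then show ?thesis unfolding poly_bounded_def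
    by (intro exI[of _ "p + q"]) (auto intro: add_mono)
qed

lemma poly_bounded_mult [pb_intros]:
  assumes "poly_bounded f" "poly_bounded g" shows "poly_bounded (\<lambda>n. f n * g n)"
proof -
  from assms obtain p q where "\<forall>n. f n \<le> poly p n" "\<forall>n. g n \<le> poly q n"
    by (auto simp: poly_bounded_def)
  then show ?thesis unfolding poly_bounded_def
    by (intro exI[of _ "p * q"]) (auto intro: mult_mono)
qed

lemma poly_bounded_poly [pb_intros]:
  assumes "poly_bounded f" shows "poly_bounded (\<lambda>n. poly q (f n))"
proof -
  from assms obtain p where "\<forall>n. f n \<le> poly p n" by (auto simp: poly_bounded_def)
  then show ?thesis unfolding poly_bounded_def
    by (intro exI[of _ "pcompose q p"]) (auto simp: poly_pcompose intro: poly_nat_mono)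
qed

definition fp :: "(sexp \<Rightarrow> sexp) \<Rightarrow> bool" where
  "fp f \<longleftrightarrow> (\<exists>P e p. \<forall>x. \<exists>t. eval P [x] e (f x) t \<and> t \<le> poly p (sexp_size x))"

lemma fpI:
  assumes "poly_bounded g"
    and "\<And>x. \<exists>t. eval P [x] e (f x) t \<and> t \<le> g (sexp_size x)"
  shows "fp f"
  using assms unfolding fp_def poly_bounded_def by (meson le_trans)

text \<open>Whatever program \<open>P\<close> is already fixed, the code for \<open>f\<close> can be
  placed behind it. Used repeatedly, this puts the code of several functions into one
  program.\<close>

lemma fp_ext:
  assumes "fp f"
  obtains Q e p where "\<And>x. \<exists>t. eval (P @ Q) [x] e (f x) t \<and> t \<le> poly p (sexp_size x)"
proof -
  from assms obtain P' e p where
    "\<And>x. \<exists>t. eval P' [x] e (f x) t \<and> t \<le> poly p (sexp_size x)"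
    unfolding fp_def by blast
  then show thesis
    by (intro that[of "map (shift (length P)) P'" "shift (length P) e" p]) (meson eval_shift)
qed

lemma fp_size:
  assumes "fp f" obtains p where "\<And>x. sexp_size (f x) \<le> poly p (sexp_size x)"
  using assms unfolding fp_def by (meson eval_size_le_cost le_trans)

lemma fp_program:
  assumes "fp f"
  obtains P p where "\<And>x. \<exists>t. runs P x (f x) t \<and> t \<le> poly p (sexp_size x)"
proof -
  from assms obtain P e p where
    *: "\<And>x. \<exists>t. eval P [x] e (f x) t \<and> t \<le> poly p (sexp_size x)"
    unfolding fp_def by blast
  \<comment> \<open>\<open>e\<close> becomes the entry point at position 0, which moves all other
    functions by one.\<close>
  have "\<exists>t. runs (shift 1 e # map (shift 1) P) x (f x) t \<and> t \<le> poly p (sexp_size x)" for x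
    using *[of x] eval_shift[of P "[x]" e "f x" _ "[shift 1 e]"] by (auto simp: runs_def)
  then show thesis by (rule that)
qed

lemma sexp_size_pos [simp]: "1 \<le> sexp_size x"
  by (cases x) auto

named_theorems fp_intros

lemma fp_id [fp_intros]: "fp (\<lambda>x. x)"
proof (rule fpI)
  show "poly_bounded (\<lambda>n. 1 + n)" by (intro pb_intros)
  show "\<exists>t. eval [] [x] (Var 0) x t \<and> t \<le> 1 + sexp_size x" for x
    using eval_Var[of 0 "[x]" "[]"] by auto
qed

lemma fp_Lit: "fp (\<lambda>x. Num c)"
proof (rule fpI)
  show "poly_bounded (\<lambda>n. 1 + sexp_size (Num c))" by (intro pb_intros)
  show "\<exists>t. eval [] [x] (Lit c) (Num c) t \<and> t \<le> 1 + sexp_size (Num c)" for x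
    using eval_Lit by blast
qed

text \<open>The intermediate value \<open>f x\<close> is no larger than the cost of computing it, so
  the bound for \<open>g\<close> is applied to a polynomial in the size of \<open>x\<close>.\<close>

lemma fp_comp:
  assumes "fp g" "fp f" shows "fp (\<lambda>x. g (f x))"
proof -
  obtain P1 e1 p1 where 1: "\<And>x. \<exists>t. eval ([] @ P1) [x] e1 (f x) t \<and> t \<le> poly p1 (sexp_size x)"
    using fp_ext[OF assms(2)] by blast
  obtain P2 e2 p2 where 2: "\<And>x. \<exists>t. eval (P1 @ P2) [x] e2 (g x) t \<and> t \<le> poly p2 (sexp_size x)"
    using fp_ext[OF assms(1)] by blast
  show ?thesis
  proof (rule fpI)
    show "poly_bounded (\<lambda>n. 1 + poly p1 n + poly p2 (poly p1 n))" by (intro pb_intros)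
    fix x
    from 1[of x] obtain t where t: "eval P1 [x] e1 (f x) t" "t \<le> poly p1 (sexp_size x)" by auto
    from 2[of "f x"] obtain s where
      s: "eval (P1 @ P2) [f x] e2 (g (f x)) s" "s \<le> poly p2 (sexp_size (f x))" by auto
    have "eval (P1 @ P2) [x] (Bind e1 e2) (g (f x)) (1 + t + s)"
      using eval_Bind[OF eval_append_program[OF t(1)]] eval_append_env[OF s(1), of "[x]"] by simp
    moreover have "s \<le> poly p2 (poly p1 (sexp_size x))"
      using s(2) eval_size_le_cost[OF t(1)] t(2)
      by (meson le_trans poly_nat_mono)
    ultimately show "\<exists>t. eval (P1 @ P2) [x] (Bind e1 e2) (g (f x)) t \<and>
        t \<le> 1 + poly p1 (sexp_size x) + poly p2 (poly p1 (sexp_size x))"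
      using t(2) by fastforce
  qed
qed

lemma floorlog_zero [simp]: "floorlog b 0 = 0"
  by (simp add: floorlog_def)

lemma floorlog_one [simp]: "floorlog 2 (Suc 0) = Suc 0"
  by (simp add: floorlog_def)

lemma floorlog_add_le: "floorlog 2 (m + n) \<le> Suc (floorlog 2 m + floorlog 2 n)"
proof (rule floorlog_leI)
  have "m < 2 ^ floorlog 2 m" "n < 2 ^ floorlog 2 n"
    using floorlog_leD[of 2 _ "floorlog 2 _"] by auto
  then have "m < 2 ^ (floorlog 2 m + floorlog 2 n)" "n < 2 ^ (floorlog 2 m + floorlog 2 n)"
    by (meson le_add1 le_add2 less_le_trans one_le_numeral power_increasing)+
  then show "m + n < 2 ^ Suc (floorlog 2 m + floorlog 2 n)" by simp
qed simp_all

lemma floorlog_diff_le: "floorlog b (m - n) \<le> floorlog b m"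
  by (rule floorlog_mono) simp

lemma sexp_size_apply_prim: "sexp_size (apply_prim f vs) \<le> 1 + sum_list (map sexp_size vs)"
  by (induction f vs rule: apply_prim.induct)
    (auto intro: le_SucI floorlog_add_le trans_le_add1 floorlog_diff_le)

lemma fp_prim1:
  assumes "fp f" shows "fp (\<lambda>x. apply_prim c [f x])"
proof -
  obtain P e p where 1: "\<And>x. \<exists>t. eval P [x] e (f x) t \<and> t \<le> poly p (sexp_size x)"
    using assms unfolding fp_def by blast
  show ?thesis
  proof (rule fpI)
    show "poly_bounded (\<lambda>n. 2 + 3 * poly p n)" by (intro pb_intros)
    fix x
    from 1[of x] obtain t where t: "eval P [x] e (f x) t" "t \<le> poly p (sexp_size x)" by auto
    have "sexp_size (f x) \<le> t" by (rule eval_size_le_cost[OF t(1)])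
    moreover have "sexp_size (apply_prim c [f x]) \<le> 1 + sexp_size (f x)"
      using sexp_size_apply_prim[of c "[f x]"] by simp
    moreover have "evals P [x] [e] [f x] (t + 0)" using t(1) by (intro eval_evals.intros)
    from eval_Prim[OF this refl, of c]
    have "eval P [x] (Prim c [e]) (apply_prim c [f x])
      (1 + t + sexp_size (f x) + sexp_size (apply_prim c [f x]))" by simp
    ultimately show "\<exists>t. eval P [x] (Prim c [e]) (apply_prim c [f x]) t \<and>
        t \<le> 2 + 3 * poly p (sexp_size x)"
      using t(2) by (intro exI conjI) auto
  qed
qed

lemma fp_prim2:
  assumes "fp f" "fp g" shows "fp (\<lambda>x. apply_prim c [f x, g x])"
proof -
  obtain P1 e1 p1 where 1: "\<And>x. \<exists>t. eval ([] @ P1) [x] e1 (f x) t \<and> t \<le> poly p1 (sexp_size x)"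
    using fp_ext[OF assms(1)] by blast
  obtain P2 e2 p2 where 2: "\<And>x. \<exists>t. eval (P1 @ P2) [x] e2 (g x) t \<and> t \<le> poly p2 (sexp_size x)"
    using fp_ext[OF assms(2)] by blast
  let ?e = "Prim c [e1, e2]"
  show ?thesis
  proof (rule fpI)
    show "poly_bounded (\<lambda>n. 2 + 3 * poly p1 n + 3 * poly p2 n)" by (intro pb_intros)
    fix x
    from 1[of x] obtain t where t: "eval P1 [x] e1 (f x) t" "t \<le> poly p1 (sexp_size x)" by auto
    from 2[of x] obtain s where
      s: "eval (P1 @ P2) [x] e2 (g x) s" "s \<le> poly p2 (sexp_size x)" by auto
    have "sexp_size (f x) \<le> t" by (rule eval_size_le_cost[OF t(1)])
    moreover have "sexp_size (g x) \<le> s" by (rule eval_size_le_cost[OF s(1)])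
    moreover have "sexp_size (apply_prim c [f x, g x]) \<le> 1 + sexp_size (f x) + sexp_size (g x)"
      using sexp_size_apply_prim[of c "[f x, g x]"] by simp
    moreover have "evals (P1 @ P2) [x] [e1, e2] [f x, g x] (t + (s + 0))"
      using eval_append_program[OF t(1)] s(1) by (intro eval_evals.intros)
    from eval_Prim[OF this refl, of c]
    have "eval (P1 @ P2) [x] ?e (apply_prim c [f x, g x])
      (1 + t + s + sexp_size (f x) + sexp_size (g x) + sexp_size (apply_prim c [f x, g x]))"
      by (simp add: add.assoc)
    ultimately show "\<exists>t. eval (P1 @ P2) [x] ?e (apply_prim c [f x, g x]) t \<and>
        t \<le> 2 + 3 * poly p1 (sexp_size x) + 3 * poly p2 (sexp_size x)"
      using t(2) s(2) by (intro exI conjI) auto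
  qed
qed

lemma fp_cond:
  assumes "fp b" "fp f" "fp g" shows "fp (\<lambda>x. if b x \<noteq> Num 0 then f x else g x)"
proof -
  obtain P1 e1 p1 where 1: "\<And>x. \<exists>t. eval ([] @ P1) [x] e1 (b x) t \<and> t \<le> poly p1 (sexp_size x)"
    using fp_ext[OF assms(1)] by blast
  obtain P2 e2 p2 where 2: "\<And>x. \<exists>t. eval (P1 @ P2) [x] e2 (f x) t \<and> t \<le> poly p2 (sexp_size x)"
    using fp_ext[OF assms(2)] by blast
  obtain P3 e3 p3 where
    3: "\<And>x. \<exists>t. eval ((P1 @ P2) @ P3) [x] e3 (g x) t \<and> t \<le> poly p3 (sexp_size x)"
    using fp_ext[OF assms(3)] by blast
  let ?e = "Cond e1 e2 e3" and ?P = "P1 @ P2 @ P3"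
  show ?thesis
  proof (rule fpI)
    show "poly_bounded (\<lambda>n. 1 + poly p1 n + poly p2 n + poly p3 n)" by (intro pb_intros)
    fix x
    from 1[of x] obtain t1 where t1: "eval ?P [x] e1 (b x) t1" "t1 \<le> poly p1 (sexp_size x)"
      by (auto dest: eval_append_program)
    from 2[of x] obtain t2 where t2: "eval ?P [x] e2 (f x) t2" "t2 \<le> poly p2 (sexp_size x)"
      by (metis append.assoc eval_append_program)
    from 3[of x] obtain t3 where t3: "eval ?P [x] e3 (g x) t3" "t3 \<le> poly p3 (sexp_size x)"
      by auto
    show "\<exists>t. eval ?P [x] ?e (if b x \<noteq> Num 0 then f x else g x) t \<and>
        t \<le> 1 + poly p1 (sexp_size x) + poly p2 (sexp_size x) + poly p3 (sexp_size x)"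
    proof (cases "b x = Num 0")
      case True
      with t1(1) t3(1) have "eval ?P [x] ?e (g x) (1 + t1 + t3)" by (simp add: eval_Suc_intros)
      with True t1 t3 show ?thesis by (intro exI[of _ "1 + t1 + t3"]) auto
    next
      case False
      with t1(1) t2(1) have "eval ?P [x] ?e (f x) (1 + t1 + t2)" by (simp add: eval_Suc_intros)
      with False t1 t2 show ?thesis by (intro exI[of _ "1 + t1 + t2"]) auto
    qed
  qed
qed

section \<open>Encoded lists and loops over them\<close>

fun scar :: "sexp \<Rightarrow> sexp" where
  "scar (Node a b) = a" | "scar (Num n) = Num 0"

fun scdr :: "sexp \<Rightarrow> sexp" where
  "scdr (Node a b) = b" | "scdr (Num n) = Num 0"

fun nval :: "sexp \<Rightarrow> nat" where
  "nval (Num n) = n" | "nval (Node a b) = 0"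

text \<open>Any number ends a list, so every S-expression denotes one; \<open>slist (lval y)\<close>
  differs from \<open>y\<close> at most in the terminator.\<close>

fun lval :: "sexp \<Rightarrow> sexp list" where
  "lval (Node a b) = a # lval b" | "lval (Num n) = []"

abbreviation slist :: "sexp list \<Rightarrow> sexp" where "slist \<equiv> enc_list id"

lemma enc_list_simps [simp]:
  "enc_list f [] = Num 0" "enc_list f (x # xs) = Node (f x) (enc_list f xs)"
  by (simp_all add: enc_list_def)

lemma lval_enc_list [simp]: "lval (enc_list f xs) = map f xs"
  by (induction xs) auto

abbreviation fpn :: "(sexp \<Rightarrow> nat) \<Rightarrow> bool" where "fpn f \<equiv> fp (\<lambda>x. Num (f x))"
abbreviation fpl :: "(sexp \<Rightarrow> sexp list) \<Rightarrow> bool" where "fpl f \<equiv> fp (\<lambda>x. slist (f x))"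

lemma fp_scar [fp_intros]: assumes "fp f" shows "fp (\<lambda>x. scar (f x))"
proof -
  have "scar y = apply_prim Car [y]" for y by (cases y) auto
  with fp_prim1[OF assms, of Car] show ?thesis by simp
qed

lemma fp_scdr [fp_intros]: assumes "fp f" shows "fp (\<lambda>x. scdr (f x))"
proof -
  have "scdr y = apply_prim Cdr [y]" for y by (cases y) auto
  with fp_prim1[OF assms, of Cdr] show ?thesis by simp
qed

lemma fp_Node [fp_intros]: "fp f \<Longrightarrow> fp g \<Longrightarrow> fp (\<lambda>x. Node (f x) (g x))"
  using fp_prim2[of f g Pairing] by simp

lemma size_lval: "sexp_size (slist (lval y)) \<le> sexp_size y"
  by (induction y) auto

text \<open>Function \<open>g\<close> is the recursion of \<open>foldr\<close> and function
  \<open>Suc g\<close> its body. Since each iteration adds at most \<open>poly q (X + L)\<close> to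
  the state, no state exceeds \<open>W\<close>; hence one iteration costs at most \<open>K\<close>
  beyond the recursive call, and there are at most \<open>sexp_size l\<close> iterations.
  \<open>X\<close>, \<open>B\<close>, \<open>L\<close> are fixed upper bounds rather than actual
  sizes, so that \<open>K\<close> stays the same while the induction descends into the list. The
  factor 100 is a generous allowance for the bookkeeping.\<close>

lemma sexp_fold_cost:
  fixes X B L :: nat and q ph :: "nat poly"
  defines "W \<equiv> B + L * poly q (X + L)"
  defines "K \<equiv> 100 * (X + B + L + W + 1) + poly ph (2 + X + L + W)"
  assumes F: "P ! g = Cond (Prim Plus [Var 1, Lit 1]) (Var 2)
      (Call (Suc g) [Prim Pairing [Prim Pairing [Var 0, Prim Car [Var 1]],
        Call g [Var 0, Prim Cdr [Var 1], Var 2]]])"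
    and g: "Suc g < length P"
    and h: "\<And>a s. \<exists>t. eval P [Node (Node x a) s] (P ! Suc g) (h a s) t \<and>
              t \<le> poly ph (sexp_size (Node (Node x a) s))"
    and growth: "\<And>a s. sexp_size (h a s) \<le> sexp_size s + poly q (sexp_size x + sexp_size a)"
    and X: "sexp_size x \<le> X" and B: "sexp_size b \<le> B"
  shows "sexp_size l \<le> L \<Longrightarrow>
    (\<exists>t. eval P [x, l, b] (P ! g) (foldr h (lval l) b) t \<and> t \<le> sexp_size l * K) \<and>
    sexp_size (foldr h (lval l) b) \<le> B + sexp_size l * poly q (X + L)"
proof (induction l)
  case (Num n)
  let ?env = "[x, Num n, b]"
  have "evals P ?env [Var 1, Lit 1] [?env ! 1, Num 1]
      ((1 + sexp_size (?env ! 1)) + ((1 + sexp_size (Num 1)) + 0))"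
    by (intro eval_evals.intros) auto
  from eval_Prim[OF this refl, of Plus] obtain t where
    t: "eval P ?env (Prim Plus [Var 1, Lit 1]) (Num (Suc n)) t"
       "t = 1 + ((1 + sexp_size (Num n)) + ((1 + sexp_size (Num 1)) + 0)) +
         (sexp_size (Num n) + sexp_size (Num 1)) + sexp_size (Num (Suc n))"
    by simp
  have "sexp_size (Num (Suc n)) \<le> 3 + sexp_size (Num n)"
    using sexp_size_apply_prim[of Plus "[Num n, Num 1]"] by simp
  with t(2) Num have t': "t \<le> 20 + 5 * L" by simp
  have "eval P ?env (Var 2) (?env ! 2) (1 + sexp_size (?env ! 2))" by (rule eval_Var) simp
  then have v: "eval P ?env (Var 2) b (1 + sexp_size b)" by simp
  have "eval P ?env (P ! g) b (1 + t + (1 + sexp_size b))"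
    unfolding F by (rule eval_Cond_true[OF t(1) _ v]) simp
  moreover have "1 + t + (1 + sexp_size b) \<le> K" using t' B by (simp add: K_def)
  moreover have "K \<le> sexp_size (Num n) * K" by simp
  ultimately show ?case using B by (auto intro: le_trans)
next
  case (Node a l)
  let ?env = "[x, Node a l, b]" and ?s = "foldr h (lval l) b"
  from Node.prems have L: "sexp_size a + sexp_size l + 1 \<le> L" by simp
  then have L': "sexp_size l \<le> L" "sexp_size a \<le> L" by auto
  from Node.IH(2)[OF L'(1)] obtain t where
    t: "eval P [x, l, b] (P ! g) ?s t" "t \<le> sexp_size l * K"
    and s: "sexp_size ?s \<le> B + sexp_size l * poly q (X + L)" by auto
  have sW: "sexp_size ?s \<le> W"
    unfolding W_def using s L'(1) by (meson add_left_mono le_trans mult_le_mono1)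
  \<comment> \<open>The test for the end of the list: adding 1 to a number gives a nonzero value,
    while \<open>Plus\<close> on a \<open>Node\<close> is ill-typed and returns
    \<open>Num 0\<close>.\<close>
  have "evals P ?env [Var 1, Lit 1] [?env ! 1, Num 1]
      ((1 + sexp_size (?env ! 1)) + ((1 + sexp_size (Num 1)) + 0))"
    by (intro eval_evals.intros) auto
  from eval_Prim[OF this refl, of Plus] obtain t1 where
    t1: "eval P ?env (Prim Plus [Var 1, Lit 1]) (Num 0) t1" "t1 \<le> 20 + 5 * L"
    using L by simp
  have V: "eval P ?env (Var 0) x (1 + sexp_size x)"
    "eval P ?env (Var (Suc 0)) (Node a l) (1 + sexp_size (Node a l))"
    "eval P ?env (Var 2) b (1 + sexp_size b)"
    using eval_Var[of 0 ?env P] eval_Var[of "Suc 0" ?env P] eval_Var[of 2 ?env P] by auto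
  have "evals P ?env [Var 1] [Node a l] (1 + sexp_size (Node a l) + 0)"
    using V by (intro eval_evals.intros) auto
  from eval_Prim[OF this refl, of Car] eval_Prim[OF this refl, of Cdr] obtain t2 t3 where
    t2: "eval P ?env (Prim Car [Var 1]) a t2" "t2 \<le> 20 + 5 * L" and
    t3: "eval P ?env (Prim Cdr [Var 1]) l t3" "t3 \<le> 20 + 5 * L"
    using L by simp
  have "evals P ?env [Var 0, Prim Car [Var 1]] [x, a] (1 + sexp_size x + (t2 + 0))"
    using V t2(1) by (intro eval_evals.intros) auto
  from eval_Prim[OF this refl, of Pairing] obtain t4 where
    t4: "eval P ?env (Prim Pairing [Var 0, Prim Car [Var 1]]) (Node x a) t4"
      "t4 \<le> 30 + 10 * L + 5 * X"
    using t2(2) X L by simp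
  have "evals P ?env [Var 0, Prim Cdr [Var 1], Var 2] [x, l, b]
     (1 + sexp_size x + (t3 + (1 + sexp_size b + 0)))"
    using V t3(1) by (intro eval_evals.intros) auto
  from eval_Call[OF this _ t(1)] g obtain t5 where
    t5: "eval P ?env (Call g [Var 0, Prim Cdr [Var 1], Var 2]) ?s t5"
        "t5 \<le> 30 + 5 * L + X + B + t"
    using t3(2) X B by simp
  have "evals P ?env [Prim Pairing [Var 0, Prim Car [Var 1]],
      Call g [Var 0, Prim Cdr [Var 1], Var 2]] [Node x a, ?s] (t4 + (t5 + 0))"
    using t4(1) t5(1) by (intro eval_evals.intros) auto
  from eval_Prim[OF this refl, of Pairing] obtain t6 where
    t6: "eval P ?env (Prim Pairing [Prim Pairing [Var 0, Prim Car [Var 1]],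
      Call g [Var 0, Prim Cdr [Var 1], Var 2]]) (Node (Node x a) ?s) t6"
      "t6 \<le> 70 + 20 * L + 10 * X + B + 2 * W + t"
    using t4(2) t5(2) X L sW by simp
  from h[of a ?s] obtain t7 where
    t7: "eval P [Node (Node x a) ?s] (P ! Suc g) (h a ?s) t7"
      "t7 \<le> poly ph (sexp_size (Node (Node x a) ?s))" by auto
  have "sexp_size (Node (Node x a) ?s) \<le> 2 + X + L + W" using X L sW by simp
  with t7(2) have t7': "t7 \<le> poly ph (2 + X + L + W)"
    using poly_nat_mono le_trans by blast
  have "evals P ?env [Prim Pairing [Prim Pairing [Var 0, Prim Car [Var 1]],
        Call g [Var 0, Prim Cdr [Var 1], Var 2]]] [Node (Node x a) ?s] (t6 + 0)"
    using t6(1) by (intro eval_evals.intros) auto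
  from eval_Call[OF this g t7(1)]
  have "eval P ?env (P ! g) (h a ?s) (1 + t1 + (1 + (t6 + 0) + t7))"
    unfolding F by (rule eval_Cond_false[OF t1(1)])
  moreover have "1 + t1 + (1 + (t6 + 0) + t7) \<le> sexp_size (Node a l) * K"
  proof -
    have "1 + t1 + (1 + (t6 + 0) + t7) \<le> K + t"
      using t1(2) t6(2) t7' by (simp add: K_def)
    also have "\<dots> \<le> (1 + sexp_size l) * K" using t(2) by simp
    also have "\<dots> \<le> sexp_size (Node a l) * K" by (rule mult_le_mono1) simp
    finally show ?thesis .
  qed
  moreover have "sexp_size (h a ?s) \<le> B + sexp_size (Node a l) * poly q (X + L)"
  proof -
    have "poly q (sexp_size x + sexp_size a) \<le> poly q (X + L)"
      using X L' by (intro poly_nat_mono add_mono)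
    then have "sexp_size (h a ?s) \<le> B + (1 + sexp_size l) * poly q (X + L)"
      using growth[of a ?s] s by simp
    also have "\<dots> \<le> B + sexp_size (Node a l) * poly q (X + L)"
      by (intro add_left_mono mult_le_mono1) simp
    finally show ?thesis .
  qed
  ultimately show ?case by auto
qed

text \<open>
  Loop bodies are represented as functions of \<open>Node (Node x a) s\<close>, where \<open>x\<close> is the environment,
  \<open>a\<close> the current list element and \<open>s\<close> the state.  The additive growth bound cannot be dropped: a
  body that doubles the state runs in polynomial time, but its iteration does not.
\<close>

lemma fp_fold_sexp:
  assumes h: "fp (\<lambda>p. h (scar (scar p)) (scdr (scar p)) (scdr p))" and l: "fp l" and b: "fp b"
    and growth: "\<And>x a s. sexp_size (h x a s) \<le> sexp_size s + poly q (sexp_size x + sexp_size a)"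
  shows "fp (\<lambda>x. foldr (h x) (lval (l x)) (b x))"
proof -
  obtain P1 el pl where 1: "\<And>x. \<exists>t. eval ([] @ P1) [x] el (l x) t \<and> t \<le> poly pl (sexp_size x)"
    using fp_ext[OF l] by blast
  obtain P2 eb pb where 2: "\<And>x. \<exists>t. eval (P1 @ P2) [x] eb (b x) t \<and> t \<le> poly pb (sexp_size x)"
    using fp_ext[OF b] by blast
  obtain P3 eh ph where 3: "\<And>y. \<exists>t. eval ((P1 @ P2) @ P3) [y] eh
      (h (scar (scar y)) (scdr (scar y)) (scdr y)) t \<and> t \<le> poly ph (sexp_size y)"
    using fp_ext[OF h] by blast
  define P0 where "P0 = P1 @ P2 @ P3"
  define g where "g = length P0"
  define F where "F = Cond (Prim Plus [Var 1, Lit 1]) (Var 2)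
      (Call (Suc g) [Prim Pairing [Prim Pairing [Var 0, Prim Car [Var 1]],
        Call g [Var 0, Prim Cdr [Var 1], Var 2]]])"
  define P where "P = P0 @ [F, eh]"
  have Pg: "P ! g = F" "P ! Suc g = eh" "Suc g < length P"
    by (simp_all add: P_def g_def nth_append)
  have ext: "eval (P1 @ P2) env e v t \<Longrightarrow> eval P env e v t"
    "eval P1 env e v t \<Longrightarrow> eval P env e v t"
    "eval P0 env e v t \<Longrightarrow> eval P env e v t" for env e v t
    by (metis P_def P0_def append.assoc eval_append_program)+
  \<comment> \<open>\<open>W\<close> and \<open>K\<close> of \<open>sexp_fold_cost\<close> with
    \<open>X\<close>, \<open>B\<close>, \<open>L\<close> replaced by \<open>n\<close>,
    \<open>poly pb n\<close>, \<open>poly pl n\<close>.\<close>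
  let ?W = "\<lambda>n. poly pb n + poly pl n * poly q (n + poly pl n)"
  let ?K = "\<lambda>n. 100 * (n + poly pb n + poly pl n + ?W n + 1) +
    poly ph (2 + n + poly pl n + ?W n)"
  show ?thesis
  proof (rule fpI)
    show "poly_bounded (\<lambda>n. 10 + n + poly pl n + poly pb n + poly pl n * ?K n)"
      by (intro pb_intros)
    fix x
    let ?n = "sexp_size x"
    from 1[of x] obtain tl where tl: "eval P [x] el (l x) tl" "tl \<le> poly pl ?n"
      by (auto dest: ext)
    from 2[of x] obtain tb where tb: "eval P [x] eb (b x) tb" "tb \<le> poly pb ?n"
      by (auto dest: ext)
    have L: "sexp_size (l x) \<le> poly pl ?n" and B: "sexp_size (b x) \<le> poly pb ?n"
      using eval_size_le_cost tl tb le_trans by blast+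
    have H: "\<exists>t. eval P [Node (Node x a) s] (P ! Suc g) (h x a s) t \<and>
              t \<le> poly ph (sexp_size (Node (Node x a) s))" for a s
      using 3[of "Node (Node x a) s"] unfolding Pg P0_def[symmetric]
      by (auto simp: P0_def dest!: ext(3)[unfolded P0_def])
    from sexp_fold_cost[OF Pg(1)[unfolded F_def] Pg(3) H growth order_refl B L]
    obtain t where t: "eval P [x, l x, b x] (P ! g) (foldr (h x) (lval (l x)) (b x)) t"
      "t \<le> sexp_size (l x) * ?K ?n" by blast
    have "eval P [x] (Var 0) x (1 + sexp_size x)" using eval_Var[of 0 "[x]" P] by simp
    then have "evals P [x] [Var 0, el, eb] [x, l x, b x] (1 + sexp_size x + (tl + (tb + 0)))"
      using tl(1) tb(1) by (intro eval_evals.intros)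
    from eval_Call[OF this _ t(1)] Pg(3)
    have "eval P [x] (Call g [Var 0, el, eb]) (foldr (h x) (lval (l x)) (b x))
      (1 + (1 + sexp_size x + (tl + (tb + 0))) + t)" by simp
    moreover have "t \<le> poly pl ?n * ?K ?n"
      using t(2) L by (meson le_trans mult_le_mono1)
    ultimately show "\<exists>t. eval P [x] (Call g [Var 0, el, eb]) (foldr (h x) (lval (l x)) (b x)) t \<and>
        t \<le> 10 + ?n + poly pl ?n + poly pb ?n + poly pl ?n * ?K ?n"
      using tl(2) tb(2) by (intro exI conjI) auto
  qed
qed

section \<open>Closure properties for numbers, truth values and list operations\<close>

definition fpb :: "(sexp \<Rightarrow> bool) \<Rightarrow> bool" where
  "fpb f \<longleftrightarrow> fp (\<lambda>x. Num (if f x then 1 else 0))"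

lemma fpn_const [fp_intros]: "fpn (\<lambda>x. c)"
  by (rule fp_Lit)

lemma fpn_nval [fp_intros]: assumes "fp f" shows "fpn (\<lambda>x. nval (f x))"
proof -
  \<comment> \<open>Adding 0 coerces to a number: on a \<open>Node\<close> the ill-typed default
    agrees with \<open>nval\<close>.\<close>
  have "Num (nval y) = apply_prim Plus [y, Num 0]" for y by (cases y) auto
  with fp_prim2[OF assms fp_Lit, of Plus 0] show ?thesis by simp
qed

lemma fpn_add [fp_intros]: "fpn f \<Longrightarrow> fpn g \<Longrightarrow> fpn (\<lambda>x. f x + g x)"
  using fp_prim2[of "\<lambda>x. Num (f x)" "\<lambda>x. Num (g x)" Plus] by simp

lemma fpn_minus [fp_intros]: "fpn f \<Longrightarrow> fpn g \<Longrightarrow> fpn (\<lambda>x. f x - g x)"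
  using fp_prim2[of "\<lambda>x. Num (f x)" "\<lambda>x. Num (g x)" Minus] by simp

lemma fpb_less [fp_intros]: "fpn f \<Longrightarrow> fpn g \<Longrightarrow> fpb (\<lambda>x. f x < g x)"
  using fp_prim2[of "\<lambda>x. Num (f x)" "\<lambda>x. Num (g x)" Less_Than] by (simp add: fpb_def)

lemma fp_if [fp_intros]:
  assumes "fpb b" "fp f" "fp g" shows "fp (\<lambda>x. if b x then f x else g x)"
proof -
  have "(Num (if b x then 1 else 0) \<noteq> Num 0) = b x" for x by simp
  with fp_cond[OF assms[unfolded fpb_def]] show ?thesis by (simp only:)
qed

lemma fpn_if [fp_intros]:
  assumes "fpb b" "fpn f" "fpn g" shows "fpn (\<lambda>x. if b x then f x else g x)"
  using fp_if[OF assms] by (simp add: if_distrib)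

lemma fpb_not [fp_intros]: assumes "fpb f" shows "fpb (\<lambda>x. \<not> f x)"
proof -
  have "(if f x then 0 else 1) = (if \<not> f x then 1 else (0 :: nat))" for x by simp
  with fpn_if[OF assms fpn_const[of 0] fpn_const[of 1]] show ?thesis by (simp only: fpb_def)
qed

lemma fpb_conj [fp_intros]: assumes "fpb f" "fpb g" shows "fpb (\<lambda>x. f x \<and> g x)"
proof -
  have "(if f x then if g x then 1 else 0 else 0) = (if f x \<and> g x then 1 else (0 :: nat))" for x
    by simp
  with fpn_if[OF assms(1) assms(2)[unfolded fpb_def] fpn_const[of 0]] show ?thesis
    by (simp only: fpb_def)
qed

lemma fpb_disj [fp_intros]: "fpb f \<Longrightarrow> fpb g \<Longrightarrow> fpb (\<lambda>x. f x \<or> g x)"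
  using fpb_not[OF fpb_conj[OF fpb_not fpb_not], of f g] by simp

lemma fpb_le [fp_intros]: assumes "fpn f" "fpn g" shows "fpb (\<lambda>x. f x \<le> g x)"
  using fpb_not[OF fpb_less[OF assms(2,1)]] by (simp add: not_less)

lemma fpb_eq [fp_intros]: assumes "fpn f" "fpn g" shows "fpb (\<lambda>x. f x = g x)"
  using fpb_conj[OF fpb_le[OF assms] fpb_le[OF assms(2,1)]] by (simp flip: eq_iff)

lemma fpl_lval [fp_intros]: assumes "fp f" shows "fpl (\<lambda>x. lval (f x))"
proof -
  have *: "foldr Node l (Num 0) = slist l" for l by (induction l) auto
  have "fp (\<lambda>x. foldr Node (lval (f x)) (Num 0))"
    by (rule fp_fold_sexp[where q = "[:1, 1:]" and h = "\<lambda>_. Node"])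
      (use assms in \<open>auto intro!: fp_intros\<close>)
  then show ?thesis by (simp add: *)
qed

lemma fp_foldr:
  assumes "fp (\<lambda>p. h (scar (scar p)) (scdr (scar p)) (scdr p))" "fpl l" "fp b"
    and "\<And>x a s. sexp_size (h x a s) \<le> sexp_size s + poly q (sexp_size x + sexp_size a)"
  shows "fp (\<lambda>x. foldr (h x) (l x) (b x))"
  using fp_fold_sexp[OF assms] by simp

text \<open>The state is kept encoded and decoded in each round by \<open>lval\<close>. The growth
  bound for lists carries over to arbitrary states because decoding and encoding again never
  enlarges a state.\<close>

lemma fpl_foldr:
  assumes h: "fpl (\<lambda>p. h (scar (scar p)) (scdr (scar p)) (lval (scdr p)))" and "fpl l" "fpl b"
    and g: "\<And>x a s. sexp_size (slist (h x a s)) \<le>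
      sexp_size (slist s) + poly q (sexp_size x + sexp_size a)"
  shows "fpl (\<lambda>x. foldr (h x) (l x) (b x))"
proof -
  have *: "foldr (\<lambda>a s. slist (h x a (lval s))) l (slist b) = slist (foldr (h x) l b)" for x l b
    by (induction l) auto
  have "fp (\<lambda>x. foldr (\<lambda>a s. slist (h x a (lval s))) (l x) (slist (b x)))"
    by (rule fp_foldr[where q = q, OF h assms(2,3)]) (meson add_le_mono1 g le_trans size_lval)
  then show ?thesis by (simp add: *)
qed

lemma fpl_Nil [fp_intros]: "fpl (\<lambda>x. [])"
  by (simp add: fp_Lit)

lemma fpl_Cons [fp_intros]: "fp f \<Longrightarrow> fpl l \<Longrightarrow> fpl (\<lambda>x. f x # l x)"
  by (simp add: fp_Node)

lemma size_slist_append: "sexp_size (slist (xs @ ys)) + 1 = sexp_size (slist xs) + sexp_size (slist ys)"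
  by (induction xs) auto

lemma fpl_append [fp_intros]: assumes "fpl l" "fpl k" shows "fpl (\<lambda>x. l x @ k x)"
proof -
  have *: "foldr Cons xs ys = xs @ ys" for xs ys :: "sexp list" by (induction xs) auto
  have "fpl (\<lambda>x. foldr Cons (l x) (k x))"
    by (rule fpl_foldr[where q = "[:1, 1:]" and h = "\<lambda>_. Cons"])
      (use assms in \<open>auto intro!: fp_intros\<close>)
  then show ?thesis by (simp add: *)
qed

lemma fp_size2:
  assumes "fp (\<lambda>p. h (scar p) (scdr p))"
  obtains q where "\<And>x a. sexp_size (h x a) \<le> poly q (sexp_size x + sexp_size a)"
proof -
  from fp_size[OF assms] obtain p where
    p: "\<And>y. sexp_size (h (scar y) (scdr y)) \<le> poly p (sexp_size y)" by blast
  \<comment> \<open>The polynomial \<open>[:1, 1:]\<close> accounts for the extra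
    \<open>Node\<close> joining \<open>x\<close> and \<open>a\<close>.\<close>
  have "sexp_size (h x a) \<le> poly (pcompose p [:1, 1:]) (sexp_size x + sexp_size a)" for x a
    using p[of "Node x a"] by (simp add: poly_pcompose)
  then show thesis by (rule that)
qed

lemma fp_body: "fp (\<lambda>p. h (scar p) (scdr p)) \<Longrightarrow> fp (\<lambda>p. h (scar (scar p)) (scdr (scar p)))"
  using fp_comp[of "\<lambda>p. h (scar p) (scdr p)" scar] by (simp add: fp_intros)

text \<open>The prototype of a loop with additive growth: a round prepends \<open>h x a\<close>,
  whose size does not depend on the state. Maps, filters and bounded quantifiers follow from
  it.\<close>

lemma fpl_concat_map [fp_intros]:
  assumes h: "fpl (\<lambda>p. h (scar p) (scdr p))" and l: "fpl l"
  shows "fpl (\<lambda>x. concat (map (h x) (l x)))"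
proof -
  obtain q where q: "\<And>x a. sexp_size (slist (h x a)) \<le> poly q (sexp_size x + sexp_size a)"
    using fp_size2[OF h] by blast
  have "fpl (\<lambda>x. foldr (\<lambda>a s. h x a @ s) (l x) [])"
  proof (rule fpl_foldr)
    show "fpl (\<lambda>p. h (scar (scar p)) (scdr (scar p)) @ lval (scdr p))"
      by (intro fp_intros fp_body[OF h])
    show "sexp_size (slist (h x a @ s)) \<le> sexp_size (slist s) + poly q (sexp_size x + sexp_size a)"
      for x a s
      using q[of x a] size_slist_append[of "h x a" s] by simp
  qed (intro fp_intros l)+
  moreover have "foldr (\<lambda>a s. h x a @ s) l [] = concat (map (h x) l)" for x l
    by (induction l) auto
  ultimately show ?thesis by simp
qed

lemma fpl_map [fp_intros]:
  assumes "fp (\<lambda>p. h (scar p) (scdr p))" "fpl l"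
  shows "fpl (\<lambda>x. map (h x) (l x))"
proof -
  have "fpl (\<lambda>x. concat (map (\<lambda>a. [h x a]) (l x)))" by (intro fp_intros assms)
  then show ?thesis by simp
qed

lemma fpl_if [fp_intros]:
  assumes "fpb b" "fpl f" "fpl g" shows "fpl (\<lambda>x. if b x then f x else g x)"
  using fp_if[OF assms] by (simp add: if_distrib)

lemma fpl_filter [fp_intros]:
  assumes "fpb (\<lambda>p. h (scar p) (scdr p))" "fpl l"
  shows "fpl (\<lambda>x. filter (h x) (l x))"
proof -
  have "concat (map (\<lambda>a. if h x a then [a] else []) l) = filter (h x) l" for x l
    by (induction l) auto
  moreover have "fpl (\<lambda>x. concat (map (\<lambda>a. if h x a then [a] else []) (l x)))"
    by (intro fp_intros assms)
  ultimately show ?thesis by simp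
qed

text \<open>Growth is additive since the binary length of a sum exceeds the two lengths together by
  at most one.\<close>

lemma fpn_sum_list [fp_intros]:
  assumes h: "fpn (\<lambda>p. h (scar p) (scdr p))" and l: "fpl l"
  shows "fpn (\<lambda>x. sum_list (map (h x) (l x)))"
proof -
  obtain q where q: "\<And>x a. sexp_size (Num (h x a)) \<le> poly q (sexp_size x + sexp_size a)"
    using fp_size2[OF h] by blast
  have "fp (\<lambda>x. foldr (\<lambda>a s. Num (h x a + nval s)) (l x) (Num 0))"
  proof (rule fp_foldr)
    show "fpn (\<lambda>p. h (scar (scar p)) (scdr (scar p)) + nval (scdr p))"
      by (intro fp_intros fp_body[OF h])
    fix x a s
    have "floorlog 2 (nval s) < sexp_size s" by (cases s) auto
    then show "sexp_size (Num (h x a + nval s)) \<le> sexp_size s + poly q (sexp_size x + sexp_size a)"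
      using q[of x a] floorlog_add_le[of "h x a" "nval s"] by simp
  qed (intro fp_intros l)+
  moreover have "foldr (\<lambda>a s. Num (h x a + nval s)) l (Num 0) = Num (sum_list (map (h x) l))" for x l
    by (induction l) auto
  ultimately show ?thesis by simp
qed

lemma fpn_length [fp_intros]: assumes "fpl l" shows "fpn (\<lambda>x. length (l x))"
proof -
  have "fpn (\<lambda>x. sum_list (map (\<lambda>_. 1) (l x)))" by (intro fp_intros assms)
  moreover have "sum_list (map (\<lambda>_. 1) k) = length k" for k :: "sexp list" by (induction k) auto
  ultimately show ?thesis by (simp only:)
qed

lemma fpb_Ball [fp_intros]:
  assumes "fpb (\<lambda>p. h (scar p) (scdr p))" "fpl l"
  shows "fpb (\<lambda>x. \<forall>a\<in>set (l x). h x a)"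
proof -
  have "fpb (\<lambda>x. length (filter (\<lambda>a. \<not> h x a) (l x)) = 0)" by (intro fp_intros assms)
  then show ?thesis by (simp add: filter_empty_conv)
qed

lemma fpb_Bex [fp_intros]:
  assumes "fpb (\<lambda>p. h (scar p) (scdr p))" "fpl l"
  shows "fpb (\<lambda>x. \<exists>a\<in>set (l x). h x a)"
proof -
  have "fpb (\<lambda>x. \<not> (\<forall>a\<in>set (l x). \<not> h x a))" by (intro fp_intros assms)
  then show ?thesis by simp
qed

definition indexed :: "sexp list \<Rightarrow> sexp list" where
  "indexed l = map (\<lambda>i. Node (Num i) (l ! i)) [0..<length l]"

lemma fpl_indexed [fp_intros]: assumes l: "fpl l" shows "fpl (\<lambda>x. indexed (l x))"
proof -
  let ?h = "\<lambda>x a (s :: sexp list). Node (Num (length (l x) - Suc (length s))) a # s"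
  obtain q where q: "\<And>x. sexp_size (Num (length (l x))) \<le> poly q (sexp_size x)"
    using fp_size[OF fpn_length[OF l]] by blast
  have "fpl (\<lambda>x. foldr (?h x) (l x) [])"
  proof (rule fpl_foldr)
    \<comment> \<open>The loop runs from the right, so the position of an element is recovered from
      the total length, recomputed from the environment, and the length of the part already
      built.\<close>
    have "fpl (\<lambda>p. l (scar (scar p)))" by (rule fp_comp[OF l]) (intro fp_intros)
    then have "fpl (\<lambda>p. Node (Num (length (l (scar (scar p))) - (length (lval (scdr p)) + 1)))
       (scdr (scar p)) # lval (scdr p))" by (intro fp_intros)
    then show "fpl (\<lambda>p. Node (Num (length (l (scar (scar p))) - Suc (length (lval (scdr p)))))
       (scdr (scar p)) # lval (scdr p))" by simp
    fix x a and s :: "sexp list"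
    have "sexp_size (Num (length (l x) - Suc (length s))) \<le> sexp_size (Num (length (l x)))"
      by (auto intro: floorlog_mono)
    also have "\<dots> \<le> poly q (sexp_size x)" by (rule q)
    also have "\<dots> \<le> poly q (sexp_size x + sexp_size a)" by (rule poly_nat_mono) simp
    finally show "sexp_size (slist (?h x a s)) \<le>
      sexp_size (slist s) + poly ([:2, 1:] + q) (sexp_size x + sexp_size a)" by simp
  qed (intro fp_intros l)+
  moreover have "foldr (?h x) (drop k (l x)) [] =
      map (\<lambda>i. Node (Num i) (l x ! i)) [k..<length (l x)]" if "k \<le> length (l x)" for x k
    using that
  proof (induction k rule: inc_induct)
    case (step k)
    then show ?case by (simp add: Cons_nth_drop_Suc[symmetric] upt_conv_Cons)
  qed simp
  from this[of 0] have "foldr (?h x) (l x) [] = indexed (l x)" for x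
    by (simp add: indexed_def)
  ultimately show ?thesis by simp
qed

text \<open>Insertion sort with the insertion point found by two filters, so that only operations
  already known to be polynomial occur.\<close>

definition isort :: "(sexp \<Rightarrow> nat) \<Rightarrow> sexp list \<Rightarrow> sexp list" where
  "isort f l = foldr (\<lambda>a s. filter (\<lambda>b. f b < f a) s @ a # filter (\<lambda>b. \<not> f b < f a) s) l []"

lemma fpl_isort:
  assumes f: "fpn f" and l: "fpl l" shows "fpl (\<lambda>x. isort f (l x))"
  unfolding isort_def
proof (rule fpl_foldr)
  note [fp_intros] = fp_comp[OF f]
  show "fpl (\<lambda>p. filter (\<lambda>b. f b < f (scdr (scar p))) (lval (scdr p)) @
    scdr (scar p) # filter (\<lambda>b. \<not> f b < f (scdr (scar p))) (lval (scdr p)))"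
    by (intro fp_intros)
  fix x a s
  have "sexp_size (slist (filter P s)) + sexp_size (slist (filter (\<lambda>b. \<not> P b) s)) =
    sexp_size (slist s) + 1" for P by (induction s) auto
  from this[of "\<lambda>b. f b < f a"]
  show "sexp_size (slist (filter (\<lambda>b. f b < f a) s @ a # filter (\<lambda>b. \<not> f b < f a) s))
    \<le> sexp_size (slist s) + poly [:1, 1:] (sexp_size x + sexp_size a)"
    using size_slist_append[of "filter (\<lambda>b. f b < f a) s" "a # filter (\<lambda>b. \<not> f b < f a) s"]
    by simp
qed (intro fp_intros l)+

lemma set_isort [simp]: "set (isort f l) = set l"
  unfolding isort_def by (induction l) auto

lemma sorted_isort: "sorted (map f (isort f l))"
  unfolding isort_def sorted_map
  by (induction l) (auto simp: sorted_wrt_append intro: sorted_wrt_filter)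

lemma distinct_isort: "distinct l \<Longrightarrow> distinct (isort f l)"
proof -
  have "mset (isort f l) = mset l"
    unfolding isort_def by (induction l) (auto simp: multiset_partition[symmetric])
  then show "distinct l \<Longrightarrow> distinct (isort f l)" by (metis mset_eq_imp_distinct_iff)
qed

definition first :: "sexp list \<Rightarrow> sexp" where
  "first l = (case l of [] \<Rightarrow> Num 0 | a # _ \<Rightarrow> a)"

lemma fp_first [fp_intros]: assumes "fpl l" shows "fp (\<lambda>x. first (l x))"
proof -
  have "scar (slist l) = first l" for l by (cases l) (auto simp: first_def)
  with fp_scar[OF assms] show ?thesis by simp
qed

section \<open>Packings\<close>

text \<open>Ties in reward are broken by the index. This makes the order strict and total, so ranks
  within a finite set are distinct.\<close>

definition before :: "(nat \<Rightarrow> nat) \<Rightarrow> nat \<Rightarrow> nat \<Rightarrow> bool" where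
  "before w d' d \<longleftrightarrow> w d < w d' \<or> w d = w d' \<and> d' < d"

definition rank_in :: "(nat \<Rightarrow> nat) \<Rightarrow> nat set \<Rightarrow> nat \<Rightarrow> nat" where
  "rank_in w X d = card {d' \<in> X. before w d' d}"

text \<open>Ranks are injective on \<open>X\<close> and below \<open>card X\<close>, hence they take
  each value in \<open>{..<card X}\<close> exactly once.\<close>

lemma card_top_ranked:
  assumes "finite X" shows "card {d \<in> X. rank_in w X d < q} = min (card X) q"
proof -
  have less: "rank_in w X d' < rank_in w X d" if "d' \<in> X" "before w d' d" for d d'
    unfolding rank_in_def using that assms
    by (intro psubset_card_mono) (auto simp: before_def psubset_eq)
  have inj: "inj_on (rank_in w X) X"
  proof (rule inj_onI, rule ccontr)
    fix d d' assume "d \<in> X" "d' \<in> X" "rank_in w X d = rank_in w X d'" "d \<noteq> d'"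
    moreover from \<open>d \<noteq> d'\<close> have "before w d d' \<or> before w d' d" by (auto simp: before_def)
    ultimately show False using less by (metis less_irrefl)
  qed
  have "rank_in w X d < card X" if "d \<in> X" for d
    unfolding rank_in_def using that assms
    by (intro psubset_card_mono) (auto simp: before_def psubset_eq)
  then have "rank_in w X ` X = {..<card X}"
    using card_image[OF inj] by (intro card_subset_eq) auto
  moreover have "rank_in w X ` {d \<in> X. rank_in w X d < q} = rank_in w X ` X \<inter> {..<q}" by auto
  ultimately have "rank_in w X ` {d \<in> X. rank_in w X d < q} = {..<min (card X) q}" by auto
  moreover have "inj_on (rank_in w X) {d \<in> X. rank_in w X d < q}"
    using inj by (rule inj_on_subset) auto
  ultimately show ?thesis by (metis card_image card_lessThan)
qed

text \<open>Exchange argument: outside their intersection, \<open>S\<close> has no more elements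
  than the top set \<open>T\<close>, and each of them weighs at most as much as any element of
  \<open>T\<close>.\<close>

lemma sum_top_ranked:
  assumes "finite X" "S \<subseteq> X" "card S \<le> q"
  shows "sum w S \<le> sum w {d \<in> X. rank_in w X d < q}"
proof -
  define T where "T = {d \<in> X. rank_in w X d < q}"
  have fin: "finite S" "finite T" using assms by (auto simp: T_def intro: finite_subset)
  have "card S \<le> card T"
    using assms card_mono[of X S] by (simp add: T_def card_top_ranked)
  then have card: "card (S - T) \<le> card (T - S)"
    using fin by (simp add: card_Diff_subset_Int Int_commute)
  \<comment> \<open>If \<open>e\<close> outweighed \<open>d\<close>, everything before
    \<open>e\<close> would be before \<open>d\<close> too, and \<open>e\<close> would have rank
    below \<open>q\<close>.\<close>
  have w: "w e \<le> w d" if "e \<in> S - T" "d \<in> T" for e d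
  proof (rule ccontr)
    assume "\<not> w e \<le> w d"
    then have "{d' \<in> X. before w d' e} \<subseteq> {d' \<in> X. before w d' d}" by (auto simp: before_def)
    then have "rank_in w X e \<le> rank_in w X d"
      unfolding rank_in_def using assms(1) by (intro card_mono) auto
    with that assms(2) show False by (auto simp: T_def)
  qed
  have "sum w (S - T) \<le> sum w (T - S)"
  proof (cases "S - T = {}")
    case False
    \<comment> \<open>\<open>m\<close> separates the differences: it bounds the weights on
      \<open>S - T\<close> and, being attained there, is at most every weight on
      \<open>T - S\<close>.\<close>
    define m where "m = Max (w ` (S - T))"
    have "m \<in> w ` (S - T)" using False fin by (auto simp: m_def intro!: Max_in)
    have "sum w (S - T) \<le> card (S - T) * m"
      using fin by (intro sum_bounded_above[where K = m, simplified]) (auto simp: m_def)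
    also have "\<dots> \<le> card (T - S) * m" using card by simp
    also have "\<dots> \<le> sum w (T - S)"
      using w \<open>m \<in> w ` (S - T)\<close> by (intro sum_bounded_below[where K = m, simplified]) auto
    finally show ?thesis .
  next
    case True
    then have "sum w (S - T) = 0" by (simp only: sum.empty)
    then show ?thesis by linarith
  qed
  then have "sum w (S - T) + sum w (S \<inter> T) \<le> sum w (T - S) + sum w (S \<inter> T)" by simp
  moreover have "sum w S = sum w (S - T) + sum w (S \<inter> T)"
    using fin by (metis add.commute sum.Int_Diff)
  moreover have "sum w T = sum w (T - S) + sum w (S \<inter> T)"
    using fin by (metis Int_commute add.commute sum.Int_Diff)
  ultimately show ?thesis by (simp add: T_def)
qed

text \<open>All that remains of the resources is the number \<open>N r\<close> of units per type;
  paths and starting locations are dealt with separately.\<close>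

locale one_or_all_packing =
  fixes D R :: "nat set" and \<tau> w :: "nat \<Rightarrow> nat" and M :: "nat \<Rightarrow> nat set" and N :: "nat \<Rightarrow> nat"
  assumes finite_D: "finite D"
    and M_cases: "d \<in> D \<Longrightarrow> M d = R \<or> (\<exists>r\<in>R. M d = {r})"
    and M_nonempty: "d \<in> D \<Longrightarrow> M d \<noteq> {}"
begin

definition packing :: "nat set \<Rightarrow> bool" where
  "packing S \<longleftrightarrow> S \<subseteq> D \<and> (\<forall>r\<in>R. \<forall>t. card {d \<in> S. \<tau> d = t \<and> r \<in> M d} \<le> N r)"

definition peers :: "nat \<Rightarrow> nat set \<Rightarrow> nat set" where
  "peers t c = {d \<in> D. \<tau> d = t \<and> M d = c}"

definition quota :: "nat \<Rightarrow> nat set \<Rightarrow> nat" where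
  "quota k c = (if c = R then k else N (the_elem c) - k)"

definition selected :: "nat \<Rightarrow> nat \<Rightarrow> bool" where
  "selected k d \<longleftrightarrow> rank_in w (peers (\<tau> d) (M d)) d < quota k (M d)"

definition gain :: "nat \<Rightarrow> nat \<Rightarrow> nat" where
  "gain t k = (\<Sum>d | d \<in> D \<and> \<tau> d = t \<and> selected k d. w d)"

text \<open>The bound \<open>card D\<close> leaves finitely many candidates, which the algorithm can
  enumerate.\<close>

definition admissible :: "nat \<Rightarrow> bool" where
  "admissible k \<longleftrightarrow> k \<le> card D \<and> (\<forall>r\<in>R. k \<le> N r)"

lemma finite_peers [simp]: "finite (peers t c)"
  using finite_D by (simp add: peers_def)

lemma peers_selected:
  "{d \<in> peers t c. rank_in w (peers t c) d < quota k c} = {d \<in> D. \<tau> d = t \<and> M d = c \<and> selected k d}"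
  by (auto simp: peers_def selected_def)

text \<open>A chosen demand using \<open>r\<close> is either for all types or for \<open>r\<close>
  alone, which gives at most \<open>k + (N r - k)\<close> of them; admissibility makes this equal to
  \<open>N r\<close>.\<close>

lemma packing_selected:
  assumes "\<And>t. admissible (\<kappa> t)"
  shows "packing {d \<in> D. selected (\<kappa> (\<tau> d)) d}"
  unfolding packing_def
proof (intro conjI ballI allI)
  fix r t assume r: "r \<in> R"
  let ?X = "\<lambda>c. {d \<in> D. \<tau> d = t \<and> M d = c \<and> selected (\<kappa> t) d}"
  have X: "card (?X c) \<le> quota (\<kappa> t) c" for c
    unfolding peers_selected[symmetric] by (simp add: card_top_ranked)
  have "{d \<in> {d \<in> D. selected (\<kappa> (\<tau> d)) d}. \<tau> d = t \<and> r \<in> M d} \<subseteq> ?X R \<union> ?X {r}"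
    using M_cases by fastforce
  then have le: "card {d \<in> {d \<in> D. selected (\<kappa> (\<tau> d)) d}. \<tau> d = t \<and> r \<in> M d} \<le> card (?X R \<union> ?X {r})"
    using finite_D by (intro card_mono) auto
  have k: "\<kappa> t \<le> N r" using assms r by (auto simp: admissible_def)
  show "card {d \<in> {d \<in> D. selected (\<kappa> (\<tau> d)) d}. \<tau> d = t \<and> r \<in> M d} \<le> N r"
  proof (cases "R = {r}")
    case True
    \<comment> \<open>With a single type the two classes coincide and must not be added;
      \<open>k\<close> alone bounds the count.\<close>
    have "card (?X R \<union> ?X {r}) = card (?X R)" unfolding True[symmetric] by simp
    moreover have "card (?X R) \<le> \<kappa> t" using X[of R] by (simp add: quota_def)
    ultimately show ?thesis using le k by linarith
  next
    case False
    then have "card (?X {r}) \<le> N r - \<kappa> t" "card (?X R) \<le> \<kappa> t"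
      using X[of R] X[of "{r}"] by (auto simp: quota_def)
    with le card_Un_le[of "?X R" "?X {r}"] k show ?thesis by linarith
  qed
qed auto

text \<open>Take for \<open>k\<close> the number of all-type demands that \<open>S\<close> itself
  uses at time \<open>t\<close>. Then \<open>S\<close> respects the quota of every class, and each
  class is dominated by its top-ranked members.\<close>

lemma packing_gain:
  assumes S: "packing S"
  obtains k where "admissible k" "sum w {d \<in> S. \<tau> d = t} \<le> gain t k"
proof -
  define k where "k = card {d \<in> S. \<tau> d = t \<and> M d = R}"
  have SD: "S \<subseteq> D" and fin: "finite S" using S finite_D by (auto simp: packing_def intro: finite_subset)
  have cap: "card {d \<in> S. \<tau> d = t \<and> r \<in> M d} \<le> N r" if "r \<in> R" for r
    using S that by (auto simp: packing_def)
  have "k \<le> N r" if "r \<in> R" for r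
  proof -
    have "k \<le> card {d \<in> S. \<tau> d = t \<and> r \<in> M d}"
      unfolding k_def using fin that by (intro card_mono) auto
    with cap[OF that] show ?thesis by linarith
  qed
  moreover have "k \<le> card D"
    unfolding k_def using SD finite_D by (intro card_mono) auto
  ultimately have "admissible k" by (simp add: admissible_def)
  have quota: "card {d \<in> S. \<tau> d = t \<and> M d = c} \<le> quota k c" if "c \<in> M ` D" for c
  proof (cases "c = R")
    case True then show ?thesis by (simp add: quota_def k_def)
  next
    case False
    with that M_cases obtain r where r: "r \<in> R" "c = {r}" by blast
    let ?A = "{d \<in> S. \<tau> d = t \<and> M d = c}" and ?B = "{d \<in> S. \<tau> d = t \<and> M d = R}"
    have "card ?A + k = card (?A \<union> ?B)"
      unfolding k_def using fin False by (subst card_Un_disjoint) auto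
    also have "\<dots> \<le> card {d \<in> S. \<tau> d = t \<and> r \<in> M d}"
      using fin r by (intro card_mono) auto
    also have "\<dots> \<le> N r" using r by (intro cap)
    finally show ?thesis using False r by (simp add: quota_def)
  qed
  have "sum w {d \<in> S. \<tau> d = t} = (\<Sum>c\<in>M ` D. sum w {d \<in> {d \<in> S. \<tau> d = t}. M d = c})"
    using fin finite_D SD by (subst sum.group) auto
  also have "\<dots> \<le> (\<Sum>c\<in>M ` D. sum w {d \<in> peers t c. rank_in w (peers t c) d < quota k c})"
    using quota SD
    by (intro sum_mono sum_top_ranked finite_peers) (auto simp: peers_def)
  also have "\<dots> = (\<Sum>c\<in>M ` D. sum w {d \<in> {d \<in> D. \<tau> d = t \<and> selected k d}. M d = c})"
    by (intro sum.cong refl arg_cong[where f = "sum w"]) (auto simp: peers_selected)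
  also have "\<dots> = gain t k"
    unfolding gain_def using finite_D by (subst sum.group) auto
  finally show thesis using \<open>admissible k\<close> that by blast
qed

lemma packing_le_selected:
  assumes "\<And>t k. admissible k \<Longrightarrow> gain t k \<le> gain t (\<kappa> t)" and S: "packing S"
  shows "sum w S \<le> sum w {d \<in> D. selected (\<kappa> (\<tau> d)) d}"
proof -
  let ?C = "{d \<in> D. selected (\<kappa> (\<tau> d)) d}"
  have SD: "S \<subseteq> D" and fin: "finite S" using S finite_D by (auto simp: packing_def intro: finite_subset)
  have "sum w S = (\<Sum>t\<in>\<tau> ` D. sum w {d \<in> S. \<tau> d = t})"
    using fin finite_D SD by (subst sum.group) auto
  also have "\<dots> \<le> (\<Sum>t\<in>\<tau> ` D. sum w {d \<in> ?C. \<tau> d = t})"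
  proof (rule sum_mono)
    fix t
    obtain k where k: "admissible k" "sum w {d \<in> S. \<tau> d = t} \<le> gain t k"
      using packing_gain[OF S] by blast
    note k(2)
    also have "gain t k \<le> gain t (\<kappa> t)" using assms k by blast
    also have "\<dots> = sum w {d \<in> ?C. \<tau> d = t}"
      unfolding gain_def by (intro arg_cong[where f = "sum w"]) auto
    finally show "sum w {d \<in> S. \<tau> d = t} \<le> sum w {d \<in> ?C. \<tau> d = t}" .
  qed
  also have "\<dots> = sum w ?C"
    using finite_D by (subst sum.group) auto
  finally show ?thesis .
qed

end

section \<open>Assigning a packing to resources\<close>

text \<open>
  No more than \<open>num_demands I\<close> resources starting at the same location are ever useful, which
  keeps the number of usable resources polynomial.
\<close>

definition useful :: "mrmd \<Rightarrow> nat \<Rightarrow> (nat \<times> nat) set" where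
  "useful I r = {(s, k). s \<in> starts I r \<and> k < capacity I r s \<and> k < num_demands I}"

definition spread_plan ::
    "mrmd \<Rightarrow> nat set \<Rightarrow> nat list \<Rightarrow> (nat \<Rightarrow> (nat \<times> nat) list) \<Rightarrow> plan" where
  "spread_plan I C L sl = concat (map (\<lambda>r. map (\<lambda>j. ((r, sl r ! j),
      filter (\<lambda>d. d \<in> C \<and> r \<in> required I d \<and>
        card {d' \<in> C. r \<in> required I d' \<and> start_time I d' = start_time I d \<and> d' < d} = j) L))
    [0..<length (sl r)]) [0..<num_types I])"

lemma distinct_concat_pairs:
  assumes "distinct rs" "\<And>r. r \<in> set rs \<Longrightarrow> distinct (f r)"
  shows "distinct (concat (map (\<lambda>r. map (Pair r) (f r)) rs))"
  using assms by (induction rs) (auto simp: distinct_map inj_on_def)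

locale unit_service_instance =
  fixes I :: mrmd
  assumes valid: "valid_instance I" and one_or_all: "one_or_all I"
    and travel: "zero_travel_times I" and durations: "unit_service_times I"
begin

sublocale one_or_all_packing "demands I" "res_types I" "start_time I" "reward I" "required I"
  "\<lambda>r. card (useful I r)"
proof
  fix d assume d: "d \<in> demands I"
  then have "required I d \<subseteq> res_types I" "card (required I d) = 1 \<or> required I d = res_types I"
    using valid one_or_all by (auto simp: one_or_all_def valid_instance_def)
  then show "required I d = res_types I \<or> (\<exists>r\<in>res_types I. required I d = {r})"
    by (auto simp: card_1_singleton_iff)
  show "required I d \<noteq> {}" using d valid by (auto simp: valid_instance_def)
qed (simp add: demands_def)

lemma finite_starts: "r \<in> res_types I \<Longrightarrow> finite (starts I r)"
  using valid by (auto simp: valid_instance_def intro: finite_subset)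

lemma finite_useful: "r \<in> res_types I \<Longrightarrow> finite (useful I r)"
  by (rule finite_subset[of _ "starts I r \<times> {..<num_demands I}"])
    (auto simp: useful_def finite_starts)

text \<open>Consecutive service requires \<open>start_time I i + 1 \<le> start_time I j\<close>, a
  strict and transitive comparison, so the condition on neighbours extends to all pairs. Every first
  demand is reachable since start times are nonnegative.\<close>

lemma path_iff:
  assumes "r \<in> res_types I" "s \<in> starts I r"
  shows "is_path I r s p \<longleftrightarrow> set p \<subseteq> {d \<in> demands I. r \<in> required I d} \<and>
    sorted_wrt (\<lambda>i j. start_time I i < start_time I j) p"
proof -
  have trans: "transp (\<lambda>i j. start_time I i < start_time I j)" by (auto intro: transpI)
  have next_iff: "can_serve_next I r i j \<longleftrightarrow>
      r \<in> required I i \<inter> required I j \<and> start_time I i < start_time I j"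
    if "i \<in> demands I" "j \<in> demands I" for i j
    using that travel durations
    by (auto simp: can_serve_next_def zero_travel_times_def unit_service_times_def locations_def)
  have first_iff: "can_serve_first I r s d \<longleftrightarrow> r \<in> required I d" if "d \<in> demands I" for d
  proof -
    have "Start s \<in> locations I" "Demand d \<in> locations I"
      using that assms valid by (auto simp: valid_instance_def locations_def)
    with travel show ?thesis by (simp add: can_serve_first_def zero_travel_times_def)
  qed
  show ?thesis
  proof (cases "set p \<subseteq> demands I")
    case True
    have "(p \<noteq> [] \<longrightarrow> can_serve_first I r s (hd p)) \<and> successively (can_serve_next I r) p \<longleftrightarrow>
      (\<forall>d\<in>set p. r \<in> required I d) \<and> successively (\<lambda>i j. start_time I i < start_time I j) p"
      using True
    proof (induction p rule: induct_list012)
      case (3 x y zs)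
      then show ?case by (auto simp: first_iff next_iff)
    qed (auto simp: first_iff)
    with True show ?thesis
      by (auto simp: is_path_def successively_conv_sorted_wrt[OF trans])
  next
    case False
    then show ?thesis by (auto simp: is_path_def)
  qed
qed

text \<open>Assign to each met demand at time \<open>t\<close> a resource of type \<open>r\<close>
  that serves it. Start times increase strictly along a path, so this choice is injective.\<close>

lemma packing_met:
  assumes \<sigma>: "feasible I \<sigma>"
  shows "packing {d \<in> demands I. met I \<sigma> d}"
  unfolding packing_def
proof (intro conjI ballI allI)
  fix r t assume r: "r \<in> res_types I"
  define X where "X = {d \<in> {d \<in> demands I. met I \<sigma> d}. start_time I d = t \<and> r \<in> required I d}"
  have XD: "X \<subseteq> demands I" by (auto simp: X_def)
  have "\<forall>d\<in>X. \<exists>a. (r, a) \<in> resources I \<and> d \<in> set (\<sigma> (r, a))"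
    by (auto simp: X_def met_def)
  then obtain g where g: "\<And>d. d \<in> X \<Longrightarrow> (r, g d) \<in> resources I \<and> d \<in> set (\<sigma> (r, g d))"
    by metis
  have inj: "inj_on g X"
  proof (rule inj_onI, rule ccontr)
    fix d d' assume d: "d \<in> X" "d' \<in> X" "g d = g d'" "d \<noteq> d'"
    obtain s k where sk: "g d = (s, k)" by fastforce
    have "is_path I r s (\<sigma> (r, s, k))" "s \<in> starts I r"
      using \<sigma> g[OF d(1)] sk by (auto simp: feasible_def resources_def)
    then have "sorted_wrt (\<lambda>i j. start_time I i < start_time I j) (\<sigma> (r, s, k))"
      using path_iff[OF r] by blast
    moreover from g[OF d(1)] g[OF d(2)] d(3) sk
    obtain i j where ij: "\<sigma> (r, s, k) ! i = d" "\<sigma> (r, s, k) ! j = d'"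
      "i < length (\<sigma> (r, s, k))" "j < length (\<sigma> (r, s, k))"
      by (auto simp: in_set_conv_nth)
    moreover have "i \<noteq> j" using d(4) ij by auto
    ultimately have "start_time I d \<noteq> start_time I d'"
      by (metis less_irrefl linorder_neqE_nat sorted_wrt_nth_less)
    with d show False by (auto simp: X_def)
  qed
  show "card {d \<in> {d \<in> demands I. met I \<sigma> d}. start_time I d = t \<and> r \<in> required I d}
    \<le> card (useful I r)"
  proof (cases "g ` X \<subseteq> useful I r")
    case True
    with card_inj_on_le[OF inj True finite_useful[OF r]] show ?thesis by (simp add: X_def)
  next
    case False
    \<comment> \<open>A resource beyond the cap shows that its location holds at least
      \<open>num_demands I\<close> units; as many of them are useful, so the bound holds
      trivially.\<close>
    then obtain d where d: "d \<in> X" "g d \<notin> useful I r" by blast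
    obtain s k where sk: "g d = (s, k)" by fastforce
    have "s \<in> starts I r" "num_demands I \<le> capacity I r s"
      using d g[OF d(1)] sk by (auto simp: useful_def resources_def)
    then have "Pair s ` {..<num_demands I} \<subseteq> useful I r" by (auto simp: useful_def)
    then have "card (Pair s ` {..<num_demands I}) \<le> card (useful I r)"
      by (intro card_mono finite_useful[OF r])
    then have "num_demands I \<le> card (useful I r)" by (simp add: card_image inj_on_def)
    moreover have "card X \<le> num_demands I"
      using card_mono[OF _ XD] by (simp add: demands_def)
    ultimately show ?thesis by (simp add: X_def)
  qed
qed auto

text \<open>The plan meets all of \<open>C\<close>, and the demands met by any feasible solution
  form a packing; maximality of \<open>C\<close> among packings therefore suffices.\<close>

lemma spread_plan_optimal:
  assumes L: "set L = demands I" "distinct L" "sorted (map (start_time I) L)"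
    and sl: "\<And>r. r \<in> res_types I \<Longrightarrow> distinct (sl r)"
      "\<And>r. r \<in> res_types I \<Longrightarrow> set (sl r) = useful I r"
    and C: "packing C" and max: "\<And>S. packing S \<Longrightarrow> sum (reward I) S \<le> sum (reward I) C"
  shows "optimal_plan I (spread_plan I C L sl)"
proof -
  define rk where "rk r d =
    card {d' \<in> C. r \<in> required I d' \<and> start_time I d' = start_time I d \<and> d' < d}" for r d
  define path where "path r j = filter (\<lambda>d. d \<in> C \<and> r \<in> required I d \<and> rk r d = j) L" for r j
  let ?pl = "spread_plan I C L sl"
  have pl: "?pl = concat (map (\<lambda>r. map (\<lambda>j. ((r, sl r ! j), path r j)) [0..<length (sl r)])
    [0..<num_types I])"
    by (simp add: spread_plan_def path_def rk_def)
  have CD: "C \<subseteq> demands I" using C by (simp add: packing_def)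
  then have finC: "finite C" using finite_D finite_subset by blast
  have rk_less: "rk r d < rk r d'"
    if "d \<in> C" "r \<in> required I d" "start_time I d = start_time I d'" "d < d'" for r d d'
    unfolding rk_def using that finC by (intro psubset_card_mono) auto
  have keys: "map fst ?pl = concat (map (\<lambda>r. map (Pair r) (sl r)) [0..<num_types I])"
  proof -
    have "map (\<lambda>j. (r, sl r ! j)) [0..<length (sl r)] = map (Pair r) (sl r)" for r
      by (intro nth_equalityI) auto
    then show ?thesis unfolding pl by (simp add: map_concat comp_def)
  qed
  have dist: "distinct (map fst ?pl)"
    unfolding keys using sl(1) by (intro distinct_concat_pairs) (auto simp: res_types_def)
  have res: "fst ` set ?pl \<subseteq> resources I"
  proof
    fix x assume "x \<in> fst ` set ?pl"
    then have "x \<in> set (map fst ?pl)" by simp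
    then obtain r a where "r < num_types I" "x = (r, a)" "a \<in> set (sl r)"
      unfolding keys by auto
    then have "r \<in> res_types I" "a \<in> useful I r" using sl(2) by (auto simp: res_types_def)
    then show "x \<in> resources I" using \<open>x = (r, a)\<close> by (auto simp: resources_def useful_def)
  qed
  have entry: "assignment_of ?pl (r, sl r ! j) = path r j"
    if "r \<in> res_types I" "j < length (sl r)" for r j
  proof -
    have "((r, sl r ! j), path r j) \<in> set ?pl"
      unfolding pl using that by (fastforce simp: res_types_def)
    from map_of_is_SomeI[OF dist this] show ?thesis by (simp add: assignment_of_def)
  qed
  have path_ok: "is_path I r s (path r j)" if "r \<in> res_types I" "s \<in> starts I r" for r s j
  proof -
    have "sorted_wrt (\<lambda>i j. start_time I i \<le> start_time I j) (path r j)" "distinct (path r j)"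
      using L by (auto simp: path_def sorted_map sorted_wrt_filter)
    then have "sorted_wrt (\<lambda>i j. start_time I i \<le> start_time I j \<and> i \<noteq> j) (path r j)"
      by (auto simp: sorted_wrt_iff_nth_less nth_eq_iff_index_eq)
    \<comment> \<open>Different chosen demands for \<open>r\<close> at the same time have different
      turns \<open>rk\<close>, whereas all demands on \<open>path r j\<close> have turn
      \<open>j\<close>.\<close>
    moreover have "start_time I a < start_time I b"
      if "a \<in> set (path r j)" "b \<in> set (path r j)" "start_time I a \<le> start_time I b \<and> a \<noteq> b" for a b
    proof (rule ccontr)
      assume "\<not> start_time I a < start_time I b"
      with that have "start_time I a = start_time I b" "a \<noteq> b" by auto
      with that rk_less[of a r b] rk_less[of b r a] show False
        by (auto simp: path_def dest: linorder_neqE_nat)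
    qed
    ultimately have "sorted_wrt (\<lambda>i j. start_time I i < start_time I j) (path r j)"
      by (rule sorted_wrt_mono_rel[rotated])
    with path_iff[OF that] L show ?thesis by (auto simp: path_def)
  qed
  have feas: "feasible I (assignment_of ?pl)"
    unfolding feasible_def
  proof clarify
    fix r s k assume rsk: "(r, s, k) \<in> resources I"
    then have r: "r \<in> res_types I" "s \<in> starts I r" by (auto simp: resources_def)
    show "is_path I r s (assignment_of ?pl (r, s, k))"
    proof (cases "map_of ?pl (r, s, k)")
      case None
      then have "assignment_of ?pl (r, s, k) = []" by (simp add: assignment_of_def)
      then show ?thesis by (simp add: is_path_def)
    next
      case (Some p)
      then have "((r, s, k), p) \<in> set ?pl" by (rule map_of_SomeD)
      then obtain j where "p = path r j" unfolding pl by auto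
      with Some path_ok[OF r] show ?thesis by (simp add: assignment_of_def)
    qed
  qed
  have "met I (assignment_of ?pl) d" if d: "d \<in> C" for d
    unfolding met_def
  proof
    fix r assume rd: "r \<in> required I d"
    with d CD valid have r: "r \<in> res_types I" by (auto simp: valid_instance_def)
    \<comment> \<open>Turns count from 0 and \<open>d\<close> does not count itself, so a resource
      exists for every turn.\<close>
    have "rk r d < card {d' \<in> C. start_time I d' = start_time I d \<and> r \<in> required I d'}"
      unfolding rk_def using finC d rd by (intro psubset_card_mono) auto
    also have "\<dots> \<le> card (useful I r)" using C r by (auto simp: packing_def)
    also have "\<dots> = length (sl r)" using sl[OF r] distinct_card by metis
    finally have j: "rk r d < length (sl r)" .
    then have "sl r ! rk r d \<in> useful I r" using sl[OF r] nth_mem by blast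
    then obtain s k where sk: "sl r ! rk r d = (s, k)" "s \<in> starts I r" "k < capacity I r s"
      by (auto simp: useful_def)
    have "d \<in> set (path r (rk r d))" using d rd CD L by (auto simp: path_def)
    then have "(r, s, k) \<in> resources I \<and> d \<in> set (assignment_of ?pl (r, s, k))"
      using entry[OF r j] sk r by (simp add: resources_def)
    then show "\<exists>s k. (r, s, k) \<in> resources I \<and> d \<in> set (assignment_of ?pl (r, s, k))"
      by blast
  qed
  then have "sum (reward I) C \<le> total_reward I (assignment_of ?pl)"
    unfolding total_reward_def using CD finite_D by (intro sum_mono2) auto
  moreover have "total_reward I \<sigma> \<le> sum (reward I) C" if "feasible I \<sigma>" for \<sigma>
    unfolding total_reward_def using packing_met[OF that] by (rule max)
  ultimately have "optimal I (assignment_of ?pl)"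
    using feas by (auto simp: optimal_def intro: le_trans)
  with dist res show ?thesis by (simp add: optimal_plan_def)
qed

end

section \<open>The algorithm\<close>

text \<open>
  In the algorithm, \<open>ds\<close> is the list of encoded demands and \<open>ts\<close> the list of encoded types, each
  entry preceded by its number; \<open>d\<close> and \<open>T\<close> stand for entries of these lists.
\<close>

definition idx :: "sexp \<Rightarrow> nat" where "idx d = nval (scar d)"
definition req :: "sexp \<Rightarrow> sexp list" where "req d = lval (scar (scdr d))"
definition tau :: "sexp \<Rightarrow> nat" where "tau d = nval (scar (scdr (scdr d)))"
definition wt :: "sexp \<Rightarrow> nat" where "wt d = nval (scar (scdr (scdr (scdr (scdr d)))))"

lemma fp_fields [fp_intros]:
  assumes "fp f"
  shows "fpn (\<lambda>x. idx (f x))" "fpl (\<lambda>x. req (f x))" "fpn (\<lambda>x. tau (f x))" "fpn (\<lambda>x. wt (f x))"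
  unfolding idx_def req_def tau_def wt_def by (intro fp_intros assms)+

text \<open>The demand numbers double as the candidate copy numbers below
  \<open>num_demands I\<close>; no range has to be generated from a binary supply, and the cap comes
  for free.\<close>

definition alg_slots :: "sexp list \<Rightarrow> sexp \<Rightarrow> sexp list" where
  "alg_slots ds T = concat (map (\<lambda>c. map (\<lambda>d. Node (scar c) (scar d))
     (filter (\<lambda>d. idx d < nval (scdr c)) ds)) (lval (scdr T)))"

lemma fpl_alg_slots [fp_intros]:
  assumes "fpl ds" "fp T" shows "fpl (\<lambda>x. alg_slots (ds x) (T x))"
  \<comment> \<open>Inside a loop body the parameters appear as \<open>ds (scar p)\<close> and the
    like; composing the assumptions by \<open>fp_comp\<close> covers these occurrences.\<close>
  unfolding alg_slots_def by (intro fp_intros assms[THEN fp_comp])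

definition alg_supply :: "sexp list \<Rightarrow> sexp list \<Rightarrow> nat \<Rightarrow> nat" where
  "alg_supply ds ts r =
     sum_list (map (\<lambda>T. if idx T = r then length (alg_slots ds T) else 0) ts)"

lemma fpn_alg_supply [fp_intros]:
  assumes "fpl ds" "fpl ts" "fpn r" shows "fpn (\<lambda>x. alg_supply (ds x) (ts x) (r x))"
  unfolding alg_supply_def by (intro fp_intros assms[THEN fp_comp])

text \<open>Equality of required sets is tested by size and smallest element only, which is sound
  because each set is a singleton or the full set.\<close>

definition alg_peer :: "sexp \<Rightarrow> sexp \<Rightarrow> bool" where
  "alg_peer d' d \<longleftrightarrow> tau d' = tau d \<and> length (req d') = length (req d) \<and>
     nval (first (req d')) = nval (first (req d))"

lemma fpb_alg_peer [fp_intros]: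
  assumes "fp d'" "fp d" shows "fpb (\<lambda>x. alg_peer (d' x) (d x))"
  unfolding alg_peer_def by (intro fp_intros assms[THEN fp_comp])

definition alg_rank :: "sexp list \<Rightarrow> sexp \<Rightarrow> nat" where
  "alg_rank ds d = length (filter (\<lambda>d'. alg_peer d' d \<and>
     (wt d < wt d' \<or> wt d = wt d' \<and> idx d' < idx d)) ds)"

lemma fpn_alg_rank [fp_intros]:
  assumes "fpl ds" "fp d" shows "fpn (\<lambda>x. alg_rank (ds x) (d x))"
  unfolding alg_rank_def by (intro fp_intros assms[THEN fp_comp])

definition alg_selected :: "sexp list \<Rightarrow> sexp list \<Rightarrow> nat \<Rightarrow> sexp \<Rightarrow> bool" where
  "alg_selected ds ts k d \<longleftrightarrow> alg_rank ds d <
     (if length (req d) = length ts then k else alg_supply ds ts (nval (first (req d))) - k)"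

lemma fpb_alg_selected [fp_intros]:
  assumes "fpl ds" "fpl ts" "fpn k" "fp d"
  shows "fpb (\<lambda>x. alg_selected (ds x) (ts x) (k x) (d x))"
  unfolding alg_selected_def by (intro fp_intros assms[THEN fp_comp])

definition alg_gain :: "sexp list \<Rightarrow> sexp list \<Rightarrow> nat \<Rightarrow> nat \<Rightarrow> nat" where
  "alg_gain ds ts t k =
     sum_list (map (\<lambda>d. if tau d = t \<and> alg_selected ds ts k d then wt d else 0) ds)"

lemma fpn_alg_gain [fp_intros]:
  assumes "fpl ds" "fpl ts" "fpn t" "fpn k"
  shows "fpn (\<lambda>x. alg_gain (ds x) (ts x) (t x) (k x))"
  unfolding alg_gain_def by (intro fp_intros assms[THEN fp_comp])

text \<open>The demand numbers followed by the number of demands are the candidates from 0 up to and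
  including \<open>num_demands I\<close>.\<close>

definition alg_admissible :: "sexp list \<Rightarrow> sexp list \<Rightarrow> sexp list" where
  "alg_admissible ds ts = filter (\<lambda>k. \<forall>T\<in>set ts. nval k \<le> length (alg_slots ds T))
     (map scar ds @ [Num (length ds)])"

lemma fpl_alg_admissible [fp_intros]:
  assumes "fpl ds" "fpl ts" shows "fpl (\<lambda>x. alg_admissible (ds x) (ts x))"
  unfolding alg_admissible_def by (intro fp_intros assms[THEN fp_comp])

definition alg_best :: "sexp list \<Rightarrow> sexp list \<Rightarrow> nat \<Rightarrow> nat" where
  "alg_best ds ts t = nval (first (filter
     (\<lambda>k. \<forall>k'\<in>set (alg_admissible ds ts). alg_gain ds ts t (nval k') \<le> alg_gain ds ts t (nval k))
     (alg_admissible ds ts)))"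

lemma fpn_alg_best [fp_intros]:
  assumes "fpl ds" "fpl ts" "fpn t" shows "fpn (\<lambda>x. alg_best (ds x) (ts x) (t x))"
  unfolding alg_best_def by (intro fp_intros assms[THEN fp_comp])

definition alg_chosen :: "sexp list \<Rightarrow> sexp list \<Rightarrow> nat \<Rightarrow> sexp \<Rightarrow> bool" where
  "alg_chosen ds ts r d \<longleftrightarrow>
     alg_selected ds ts (alg_best ds ts (tau d)) d \<and> (\<exists>a\<in>set (req d). nval a = r)"

lemma fpb_alg_chosen [fp_intros]:
  assumes "fpl ds" "fpl ts" "fpn r" "fp d"
  shows "fpb (\<lambda>x. alg_chosen (ds x) (ts x) (r x) (d x))"
  unfolding alg_chosen_def by (intro fp_intros assms[THEN fp_comp])

definition alg_path :: "sexp list \<Rightarrow> sexp list \<Rightarrow> nat \<Rightarrow> nat \<Rightarrow> sexp list" where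
  "alg_path ds ts r j = map scar (filter (\<lambda>d. alg_chosen ds ts r d \<and>
      length (filter (\<lambda>d'. alg_chosen ds ts r d' \<and> tau d' = tau d \<and> idx d' < idx d) ds) = j)
    (isort tau ds))"

lemma fpl_alg_path [fp_intros]:
  assumes "fpl ds" "fpl ts" "fpn r" "fpn j"
  shows "fpl (\<lambda>x. alg_path (ds x) (ts x) (r x) (j x))"
  unfolding alg_path_def by (intro fp_intros fpl_isort assms[THEN fp_comp])

definition alg_plan :: "sexp list \<Rightarrow> sexp list \<Rightarrow> sexp list" where
  "alg_plan ds ts = concat (map (\<lambda>T. map (\<lambda>s.
      Node (slist [scar T, scar (scdr s), scdr (scdr s)]) (slist (alg_path ds ts (idx T) (idx s))))
    (indexed (alg_slots ds T))) ts)"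

lemma fpl_alg_plan [fp_intros]:
  assumes "fpl ds" "fpl ts" shows "fpl (\<lambda>x. alg_plan (ds x) (ts x))"
  unfolding alg_plan_def by (intro fp_intros assms[THEN fp_comp])

definition algorithm :: "sexp \<Rightarrow> sexp" where
  "algorithm x = slist (alg_plan (indexed (lval (scar (scdr (scdr (scdr (scdr x)))))))
     (indexed (lval (scar (scdr (scdr (scdr x)))))))"

lemma fp_algorithm: "fp algorithm"
proof -
  have "fp (\<lambda>x. algorithm x)" unfolding algorithm_def by (intro fp_intros)
  then show ?thesis by simp
qed

section \<open>Correctness of the algorithm on encoded instances\<close>

context unit_service_instance
begin

lemma in_demands: "d \<in> demands I \<longleftrightarrow> d < num_demands I"
  by (simp add: demands_def)

lemma in_res_types: "r \<in> res_types I \<longleftrightarrow> r < num_types I"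
  by (simp add: res_types_def)

lemma card_demands [simp]: "card (demands I) = num_demands I"
  by (simp add: demands_def)

lemma card_res_types [simp]: "card (res_types I) = num_types I"
  by (simp add: res_types_def)

lemma finite_res_types [simp]: "finite (res_types I)"
  by (simp add: res_types_def)

definition item :: "nat \<Rightarrow> sexp" where "item d = Node (Num d) (enc_demand I d)"
definition type_item :: "nat \<Rightarrow> sexp" where "type_item r = Node (Num r) (enc_type I r)"
definition items :: "sexp list" where "items = map item [0..<num_demands I]"
definition type_items :: "sexp list" where "type_items = map type_item [0..<num_types I]"

definition slot_list :: "nat \<Rightarrow> (nat \<times> nat) list" where
  "slot_list r = concat (map (\<lambda>s. map (Pair s)
     (filter (\<lambda>k. k < capacity I r s) [0..<num_demands I])) (sorted_list_of_set (starts I r)))"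

lemma indexed_map_upt: "indexed (map f [0..<n]) = map (\<lambda>i. Node (Num i) (f i)) [0..<n]"
  by (simp add: indexed_def)

lemma algorithm_enc_instance:
  "algorithm (enc_instance I) = slist (alg_plan items type_items)"
  by (simp add: algorithm_def enc_instance_def indexed_map_upt item_def[abs_def] items_def
      type_item_def[abs_def] type_items_def)

lemma item_simps [simp]:
  "idx (item d) = d" "tau (item d) = start_time I d" "wt (item d) = reward I d"
  "req (item d) = map Num (sorted_list_of_set (required I d))"
  "scar (item d) = Num d" "idx (type_item r) = r" "scar (type_item r) = Num r"
  by (simp_all add: item_def type_item_def idx_def tau_def wt_def req_def enc_demand_def)

lemma required_subset: "d \<in> demands I \<Longrightarrow> required I d \<subseteq> res_types I"
  using valid by (simp add: valid_instance_def)

lemma finite_required: "d \<in> demands I \<Longrightarrow> finite (required I d)"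
  using required_subset finite_subset by (metis finite_res_types)

lemma slot_list:
  assumes "r \<in> res_types I"
  shows "distinct (slot_list r)" "set (slot_list r) = useful I r"
    "length (slot_list r) = card (useful I r)"
proof -
  show dist: "distinct (slot_list r)"
    unfolding slot_list_def by (intro distinct_concat_pairs) auto
  show "set (slot_list r) = useful I r"
    using finite_starts[OF assms] by (auto simp: slot_list_def useful_def)
  with distinct_card[OF dist] show "length (slot_list r) = card (useful I r)" by simp
qed

lemma alg_slots_items:
  "alg_slots items (type_item r) = map (\<lambda>(s, k). Node (Num s) (Num k)) (slot_list r)"
  by (simp add: alg_slots_def items_def type_item_def enc_type_def slot_list_def map_concat
      filter_map comp_def)

lemma alg_supply_items:
  assumes "r \<in> res_types I" shows "alg_supply items type_items r = card (useful I r)"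
proof -
  have "alg_supply items type_items r =
      (\<Sum>r' = 0..<num_types I. if r' = r then length (slot_list r') else 0)"
    by (simp add: alg_supply_def type_items_def alg_slots_items comp_def
        interv_sum_list_conv_sum_set_nat)
  also have "\<dots> = card (useful I r)"
    using assms slot_list(3) by (simp add: in_res_types)
  finally show ?thesis .
qed

lemma nval_first_req:
  "nval (first (map Num (sorted_list_of_set {r}))) = r"
  by (simp add: first_def)

text \<open>If one of the sets is full, equal cardinality forces the other to be full; otherwise
  both are singletons and the first element decides.\<close>

lemma required_eq_iff:
  assumes "d \<in> demands I" "d' \<in> demands I"
  shows "card (required I d') = card (required I d) \<and>
    nval (first (req (item d'))) = nval (first (req (item d))) \<longleftrightarrow> required I d' = required I d"
    (is "?l \<longleftrightarrow> ?r")
proof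
  assume l: ?l
  have eq: "required I a = required I b" if "a \<in> demands I" "required I b = res_types I"
    "card (required I a) = card (required I b)" for a b
    using that required_subset[of a] by (intro card_subset_eq) auto
  show ?r
  proof (cases "required I d = res_types I \<or> required I d' = res_types I")
    case True
    then show ?thesis
    proof
      assume "required I d = res_types I"
      from eq[OF assms(2) this l[THEN conjunct1]] show ?thesis .
    next
      assume "required I d' = res_types I"
      from eq[OF assms(1) this l[THEN conjunct1, symmetric]] show ?thesis by (rule sym)
    qed
  next
    case False
    then obtain r r' where "required I d = {r}" "required I d' = {r'}"
      using M_cases[OF assms(1)] M_cases[OF assms(2)] by blast
    moreover from l[THEN conjunct2] this have "r' = r" by (simp only: item_simps nval_first_req)
    ultimately show ?thesis by (simp only:)
  qed
qed auto

lemma alg_rank_item: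
  assumes d: "d \<in> demands I"
  shows "alg_rank items (item d) =
    rank_in (reward I) (peers (start_time I d) (required I d)) d"
proof -
  have peer: "alg_peer (item d') (item d) \<longleftrightarrow> d' \<in> peers (start_time I d) (required I d)"
    if "d' \<in> demands I" for d'
    using required_eq_iff[OF d that] that by (auto simp: alg_peer_def peers_def)
  have "alg_rank items (item d) = card {d'. d' < num_demands I \<and> alg_peer (item d') (item d) \<and>
     before (reward I) d' d}"
    by (auto simp: alg_rank_def items_def filter_map comp_def before_def length_filter_conv_card
       intro!: arg_cong[where f = card])
  also have "{d'. d' < num_demands I \<and> alg_peer (item d') (item d) \<and> before (reward I) d' d} =
    {d' \<in> peers (start_time I d) (required I d). before (reward I) d' d}"
    using peer by (auto simp: in_demands peers_def)
  finally show ?thesis by (simp add: rank_in_def)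
qed

lemma alg_selected_item:
  assumes d: "d \<in> demands I"
  shows "alg_selected items type_items k (item d) \<longleftrightarrow> selected k d"
proof -
  have "(if length (req (item d)) = length type_items then k
      else alg_supply items type_items (nval (first (req (item d)))) - k) = quota k (required I d)"
  proof (cases "required I d = res_types I")
    case True
    then show ?thesis by (simp add: quota_def type_items_def)
  next
    case False
    with M_cases[OF d] obtain r where r: "r \<in> res_types I" "required I d = {r}" by blast
    have "card (required I d) \<noteq> card (res_types I)"
      using card_subset_eq[OF _ required_subset[OF d]] False by auto
    then have "length (req (item d)) \<noteq> length type_items"
      by (simp add: type_items_def)
    with False r show ?thesis by (simp add: quota_def first_def alg_supply_items)
  qed
  with alg_rank_item[OF d] show ?thesis by (simp add: alg_selected_def selected_def del: item_simps)
qed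

lemma alg_gain_items: "alg_gain items type_items t k = gain t k"
proof -
  have "alg_gain items type_items t k =
    (\<Sum>d = 0..<num_demands I. if start_time I d = t \<and> selected k d then reward I d else 0)"
    unfolding alg_gain_def items_def
    by (simp add: comp_def interv_sum_list_conv_sum_set_nat)
      (auto intro!: sum.cong simp: alg_selected_item[unfolded items_def] in_demands)
  also have "\<dots> = gain t k"
    unfolding gain_def by (subst sum.inter_filter[symmetric]) (auto simp: in_demands intro!: sum.cong)
  finally show ?thesis .
qed

lemma set_alg_admissible: "set (alg_admissible items type_items) = Num ` {k. admissible k}"
proof -
  have "set (map scar items @ [Num (length items)]) = Num ` {..num_demands I}"
    by (auto simp: items_def le_less)
  moreover have "(\<forall>T\<in>set type_items. k \<le> length (alg_slots items T)) \<longleftrightarrow>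
      (\<forall>r\<in>res_types I. k \<le> card (useful I r))" for k
    using slot_list(3) by (auto simp: type_items_def alg_slots_items in_res_types)
  ultimately show ?thesis
    unfolding alg_admissible_def set_filter by (auto simp: admissible_def)
qed

lemma alg_best_items:
  "admissible (alg_best items type_items t)"
  "admissible k \<Longrightarrow> gain t k \<le> gain t (alg_best items type_items t)"
proof -
  let ?B = "filter (\<lambda>k. \<forall>k'\<in>set (alg_admissible items type_items).
    alg_gain items type_items t (nval k') \<le> alg_gain items type_items t (nval k))
     (alg_admissible items type_items)"
  have B: "set ?B = Num ` {k. admissible k \<and> (\<forall>k'. admissible k' \<longrightarrow> gain t k' \<le> gain t k)}"
    by (auto simp: set_alg_admissible alg_gain_items)
  have fin: "finite {k. admissible k}"
    by (rule finite_subset[of _ "{..card (demands I)}"]) (auto simp: admissible_def)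
  \<comment> \<open>Guarantees that a maximum exists, so \<open>first\<close> is applied to a
    nonempty list and its default value is never returned.\<close>
  moreover have "admissible 0" by (simp add: admissible_def)
  ultimately have "Max (gain t ` {k. admissible k}) \<in> gain t ` {k. admissible k}"
    by (intro Max_in) auto
  then obtain m where "admissible m" "gain t m = Max (gain t ` {k. admissible k})" by auto
  with fin
  have "\<exists>k. admissible k \<and> (\<forall>k'. admissible k' \<longrightarrow> gain t k' \<le> gain t k)" by auto
  then have "set ?B \<noteq> {}" unfolding B by blast
  then have "first ?B \<in> set ?B" by (cases ?B) (auto simp: first_def)
  then have "alg_best items type_items t \<in>
      {k. admissible k \<and> (\<forall>k'. admissible k' \<longrightarrow> gain t k' \<le> gain t k)}"
    unfolding B alg_best_def by auto
  then show "admissible (alg_best items type_items t)"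
    "admissible k \<Longrightarrow> gain t k \<le> gain t (alg_best items type_items t)" by auto
qed

lemma algorithm_optimal: "\<exists>pl. optimal_plan I pl \<and> enc_plan pl = algorithm (enc_instance I)"
proof -
  define C where "C = {d \<in> demands I. selected (alg_best items type_items (start_time I d)) d}"
  define L where "L = map idx (isort tau items)"
  have set_items: "set items = item ` demands I" by (auto simp: items_def in_demands)
  \<comment> \<open>On encoded demands \<open>idx\<close> inverts \<open>item\<close>, so the sorted
    list of encodings is the image of a list \<open>L\<close> of demand numbers, as
    \<open>spread_plan\<close> expects.\<close>
  have "item (idx d) = d" if "d \<in> set items" for d using that by (auto simp: set_items)
  then have "map (item \<circ> idx) (isort tau items) = isort tau items" by (intro map_idI) simp
  then have sorted_items: "isort tau items = map item L" by (simp add: L_def)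
  have "distinct items"
    unfolding items_def by (auto simp: distinct_map inj_on_def item_def)
  then have "distinct (map item L)" unfolding sorted_items[symmetric] by (rule distinct_isort)
  then have L: "distinct L" by (simp add: distinct_map)
  have setL: "set L = demands I" unfolding L_def by (force simp: set_items)
  have sortedL: "sorted (map (start_time I) L)"
    using sorted_isort[of tau items] unfolding sorted_items by (simp add: comp_def)
  let ?pl = "spread_plan I C L slot_list"
  have "optimal_plan I ?pl"
  proof (rule spread_plan_optimal[OF setL L sortedL])
    show "packing C" unfolding C_def by (intro packing_selected alg_best_items)
    show "sum (reward I) S \<le> sum (reward I) C" if "packing S" for S
      unfolding C_def using that by (intro packing_le_selected alg_best_items)
  qed (simp_all add: slot_list)
  moreover have "enc_plan ?pl = algorithm (enc_instance I)"
  proof -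
    have chosen: "alg_chosen items type_items r (item d) \<longleftrightarrow> d \<in> C \<and> r \<in> required I d"
      if "d \<in> demands I" for r d
      using that finite_required by (auto simp: alg_chosen_def C_def alg_selected_item)
    \<comment> \<open>The counted list length is the turn by which \<open>spread_plan\<close>
      assigns \<open>d\<close> to a resource.\<close>
    have turn: "length (filter (\<lambda>d'. alg_chosen items type_items r d' \<and>
        tau d' = tau (item d) \<and> idx d' < idx (item d)) items) =
      card {d' \<in> C. r \<in> required I d' \<and> start_time I d' = start_time I d \<and> d' < d}" for r d
    proof -
      have "length (filter (\<lambda>d'. alg_chosen items type_items r d' \<and>
        tau d' = tau (item d) \<and> idx d' < idx (item d)) items) =
        card {d'. d' < num_demands I \<and> alg_chosen items type_items r (item d') \<and>
          start_time I d' = start_time I d \<and> d' < d}"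
        by (auto simp: items_def filter_map comp_def length_filter_conv_card
          intro!: arg_cong[where f = card])
      also have "{d'. d' < num_demands I \<and> alg_chosen items type_items r (item d') \<and>
          start_time I d' = start_time I d \<and> d' < d} =
        {d' \<in> C. r \<in> required I d' \<and> start_time I d' = start_time I d \<and> d' < d}"
        using chosen by (auto simp: C_def in_demands)
      finally show ?thesis .
    qed
    have path: "alg_path items type_items r j = map Num (filter (\<lambda>d. d \<in> C \<and> r \<in> required I d \<and>
        card {d' \<in> C. r \<in> required I d' \<and> start_time I d' = start_time I d \<and> d' < d} = j) L)"
      for r j
    proof -
      have "alg_path items type_items r j =
        map (scar \<circ> item) (filter (\<lambda>d. alg_chosen items type_items r (item d) \<and>
          length (filter (\<lambda>d'. alg_chosen items type_items r d' \<and>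
            tau d' = tau (item d) \<and> idx d' < idx (item d)) items) = j) L)"
        unfolding alg_path_def sorted_items filter_map map_map by (simp add: comp_def)
      also have "\<dots> = map Num (filter (\<lambda>d. d \<in> C \<and> r \<in> required I d \<and>
        card {d' \<in> C. r \<in> required I d' \<and> start_time I d' = start_time I d \<and> d' < d} = j) L)"
        unfolding turn using chosen setL by (auto intro!: map_cong filter_cong)
      finally show ?thesis .
    qed
    have entry: "enc_entry ((r, s), p) =
      Node (slist [Num r, Num (fst s), Num (snd s)]) (slist (map Num p))" for r s p
    proof -
      have "enc_list Num p = slist (map Num p)" for p by (induction p) auto
      then show ?thesis by (cases s) simp
    qed
    have enc: "enc_plan pl = slist (map enc_entry pl)" for pl
      unfolding enc_plan_def by (induction pl) auto
    have indexed_slots: "indexed (alg_slots items (type_item r)) =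
      map (\<lambda>j. Node (Num j) (Node (Num (fst (slot_list r ! j))) (Num (snd (slot_list r ! j)))))
        [0..<length (slot_list r)]" for r
      unfolding alg_slots_items indexed_def by (auto simp: case_prod_beta)
    show ?thesis
      unfolding algorithm_enc_instance enc
      by (rule arg_cong[where f = slist])
        (simp add: alg_plan_def spread_plan_def type_items_def indexed_slots path[symmetric]
          map_concat comp_def entry idx_def del: enc_entry.simps)
  qed
  ultimately show ?thesis by blast
qed

end

theorem theorem6:
  shows "poly_time_solvable
    (\<lambda>I. valid_instance I \<and> one_or_all I \<and> zero_travel_times I \<and> unit_service_times I)
    enc_instance optimal_plan enc_plan"
proof -
  obtain P p where P: "\<And>x. \<exists>t. runs P x (algorithm x) t \<and> t \<le> poly p (sexp_size x)"
    using fp_program[OF fp_algorithm] by blast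
  show ?thesis
    unfolding poly_time_solvable_def
  proof (intro exI[of _ P] exI[of _ p] allI impI)
    fix I assume "valid_instance I \<and> one_or_all I \<and> zero_travel_times I \<and> unit_service_times I"
    then interpret unit_service_instance I by unfold_locales auto
    from algorithm_optimal P[of "enc_instance I"]
    show "\<exists>y t. optimal_plan I y \<and> runs P (enc_instance I) (enc_plan y) t \<and>
        t \<le> poly p (sexp_size (enc_instance I))" by metis
  qed
qed

end
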